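(* For an integer $N\ge1$ let $p_N=(z-w)^N$ and let $Y_N=[S_z^*,S_w]=S_z^*S_w-S_wS_z^*$ on $\mathcal Q_{p_N}=H^2(\mathbb D^2)\ominus[p_N]$. Put $$t_{n,N}=\frac{((n+N)!)^2}{n!\,(n+2N)!}.$$ Then $$\beta_{0,N}=1-\binom{2N}{N}^{-1},\qquad \beta_{n,N}=\frac{N}{n+N}(1-t_{n,N})\quad(n\ge1)$$ are all the non-zero singular values of $Y_N$ (counted with multiplicity, before decreasing rearrangement). Furthermore, $$\frac N4\left(1-\left(\frac23\right)^N\right)^2\le\|Y_N\|_{HS}^2<N+1,$$ and, more precisely, $$\lim_{N\to\infty}\frac{\|Y_N\|_{HS}^2}{N}=1 .$$ In particular, there is no uniform bound for the Hilbert--Schmidt norms of the operators $[S_z^*,S_w]$ on the quotients $H^2(\mathbb D^2)\ominus[p]$, $p$ a non-constant homogeneous polynomial.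
   Context: $H^2(\mathbb D^2)$ is the Hardy space of the bidisc and $[p]$ the closure of $p\,\mathbb C[z,w]$ in it. On $\mathcal Q_p=H^2(\mathbb D^2)\ominus[p]$, $S_z=P_{\mathcal Q_p}M_z|_{\mathcal Q_p}$ and $S_w=P_{\mathcal Q_p}M_w|_{\mathcal Q_p}$ are the compressions of multiplication by $z$ and $w$. $\|\cdot\|_{HS}$ is the Hilbert--Schmidt norm. *)

theory Defs
  imports "HOL-Analysis.Analysis" "HOL-Computational_Algebra.Polynomial"
begin

section \<open>The Hardy space of the bidisc\<close>

definition bidisc :: "(complex \<times> complex) set" where
  "bidisc = ball 0 1 \<times> ball 0 1"

definition square_summable :: "(nat \<times> nat \<Rightarrow> complex) \<Rightarrow> bool" where
  "square_summable a \<longleftrightarrow> (\<lambda>k. (cmod (a k))\<^sup>2) summable_on UNIV"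

text \<open>Functions on the bidisc are represented by total functions vanishing outside of it.\<close>

definition bidisc_series :: "(nat \<times> nat \<Rightarrow> complex) \<Rightarrow> complex \<times> complex \<Rightarrow> complex" where
  "bidisc_series a = (\<lambda>(z, w). if (z, w) \<in> bidisc
      then \<Sum>\<^sub>\<infinity>(i, j)\<in>UNIV. a (i, j) * (z ^ i * w ^ j) else 0)"

lemma square_summable_abs_product:
  assumes "square_summable a" "square_summable b"
  shows "(\<lambda>k. norm (a k * b k)) summable_on UNIV"
  by (rule Infinite_Sum.abs_summable_product)
    (use assms in \<open>simp_all add: square_summable_def norm_mult power2_eq_square\<close>)

lemma square_summable_add:
  assumes "square_summable a" "square_summable b"
  shows "square_summable (\<lambda>k. a k + b k)"
proof -
  have "(\<lambda>k. 2 * (cmod (a k))\<^sup>2 + 2 * (cmod (b k))\<^sup>2) summable_on UNIV"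
    using assms unfolding square_summable_def
    by (intro summable_on_add summable_on_cmult_right)
  then show ?thesis unfolding square_summable_def
  proof (rule summable_on_comparison_test)
    fix k
    have "(cmod (a k + b k))\<^sup>2 \<le> (cmod (a k) + cmod (b k))\<^sup>2"
      by (intro power_mono norm_triangle_ineq) auto
    also have "\<dots> \<le> 2 * (cmod (a k))\<^sup>2 + 2 * (cmod (b k))\<^sup>2"
      using zero_le_power2[of "cmod (a k) - cmod (b k)"]
      by (simp add: power2_eq_square algebra_simps)
    finally show "(cmod (a k + b k))\<^sup>2 \<le> 2 * (cmod (a k))\<^sup>2 + 2 * (cmod (b k))\<^sup>2" .
  qed auto
qed

lemma square_summable_cmult:
  assumes "square_summable a"
  shows "square_summable (\<lambda>k. c * a k)"
  using assms unfolding square_summable_def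
  by (simp add: norm_mult power_mult_distrib summable_on_cmult_right)

lemma square_summable_cnj: "square_summable (\<lambda>k. cnj (a k)) \<longleftrightarrow> square_summable a"
  unfolding square_summable_def by simp

lemma square_summable_monomials:
  assumes "(z, w) \<in> bidisc"
  shows "square_summable (\<lambda>(i, j). z ^ i * w ^ j)"
proof -
  have 1: "cmod z < 1" "cmod w < 1" using assms by (auto simp: bidisc_def)
  then have q: "(cmod z)\<^sup>2 < 1" "(cmod w)\<^sup>2 < 1"
    by (simp_all add: power_less_one_iff)
  have g: "(\<lambda>i. x ^ i) summable_on (UNIV :: nat set)" if "0 \<le> x" "x < 1" for x :: real
    using that by (intro summable_nonneg_imp_summable_on) (auto intro: summable_geometric)
  have "(\<lambda>(i, j). ((cmod z)\<^sup>2) ^ i * ((cmod w)\<^sup>2) ^ j) summable_on (UNIV \<times> UNIV :: (nat \<times> nat) set)"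
  proof (rule summable_on_SigmaI)
    fix i :: nat
    show "((\<lambda>j. case (i, j) of (i, j) \<Rightarrow> ((cmod z)\<^sup>2) ^ i * ((cmod w)\<^sup>2) ^ j)
        has_sum (((cmod z)\<^sup>2) ^ i * (\<Sum>\<^sub>\<infinity>j. ((cmod w)\<^sup>2) ^ j))) UNIV"
      using has_sum_cmult_right[OF has_sum_infsum[OF g[of "(cmod w)\<^sup>2"]]] q by simp
    show "(\<lambda>i. ((cmod z)\<^sup>2) ^ i * (\<Sum>\<^sub>\<infinity>j. ((cmod w)\<^sup>2) ^ j)) summable_on UNIV"
      using g[of "(cmod z)\<^sup>2"] q by (intro summable_on_cmult_left) simp
  qed auto
  moreover have "(cmod (case k of (i, j) \<Rightarrow> z ^ i * w ^ j))\<^sup>2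
      = (case k of (i, j) \<Rightarrow> ((cmod z)\<^sup>2) ^ i * ((cmod w)\<^sup>2) ^ j)" for k
    by (cases k) (simp add: norm_mult norm_power power_mult_distrib mult.commute flip: power_mult)
  ultimately show ?thesis unfolding square_summable_def by simp
qed

lemma bidisc_series_abs_summable:
  assumes "square_summable a" "(z, w) \<in> bidisc"
  shows "(\<lambda>k. norm (case k of (i, j) \<Rightarrow> a (i, j) * (z ^ i * w ^ j))) summable_on UNIV"
  using square_summable_abs_product[OF assms(1) square_summable_monomials[OF assms(2)]]
  by (simp add: case_prod_unfold)

lemma bidisc_series_summable:
  assumes "square_summable a" "(z, w) \<in> bidisc"
  shows "(\<lambda>(i, j). a (i, j) * (z ^ i * w ^ j)) summable_on UNIV"
  using abs_summable_summable[OF bidisc_series_abs_summable[OF assms]] .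

lemma bidisc_series_add:
  assumes "square_summable a" "square_summable b"
  shows "bidisc_series (\<lambda>k. a k + b k) = (\<lambda>x. bidisc_series a x + bidisc_series b x)"
proof
  fix x :: "complex \<times> complex"
  obtain z w where x: "x = (z, w)" by (cases x)
  show "bidisc_series (\<lambda>k. a k + b k) x = bidisc_series a x + bidisc_series b x"
  proof (cases "(z, w) \<in> bidisc")
    case True
    then show ?thesis
      using infsum_add[OF bidisc_series_summable[OF assms(1) True] bidisc_series_summable[OF assms(2) True]]
      by (simp add: x bidisc_series_def case_prod_unfold ring_distribs)
  qed (simp add: x bidisc_series_def)
qed

lemma bidisc_series_cmult:
  "bidisc_series (\<lambda>k. c * a k) = (\<lambda>x. c * bidisc_series a x)"
  by (auto simp: bidisc_series_def fun_eq_iff case_prod_unfold mult.assoc infsum_cmult_right')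

lemma square_summable_zero: "square_summable (\<lambda>_. 0)"
  by (simp add: square_summable_def)

lemma bidisc_series_zero: "bidisc_series (\<lambda>_. 0) = (\<lambda>_. 0)"
  using bidisc_series_cmult[of 0 "\<lambda>_. 0"] by simp

lemma power_series_unique:
  fixes c :: "nat \<Rightarrow> complex"
  assumes "\<And>z. z \<in> ball 0 1 \<Longrightarrow> (\<lambda>i. c i * z ^ i) summable_on UNIV"
    and "\<And>z. z \<in> ball 0 1 \<Longrightarrow> (\<Sum>\<^sub>\<infinity>i. c i * z ^ i) = 0"
  shows "c i = 0"
proof -
  have s: "(\<lambda>i. c i * z ^ i) sums 0" if "z \<in> ball 0 1" for z
    using has_sum_imp_sums[OF has_sum_infsum[OF assms(1)[OF that]]] assms(2)[OF that] by simp
  have "conv_radius c \<ge> norm (1 / 2 :: complex)"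
    by (rule conv_radius_geI) (use s[of "1/2"] in \<open>simp add: sums_iff\<close>)
  then have r: "fps_conv_radius (Abs_fps c) > 0"
    by (simp add: fps_conv_radius_def less_le_trans[of 0 "ereal (1/2)"] norm_divide)
  have "eventually (\<lambda>z. z \<in> ball 0 1) (nhds (0 :: complex))"
    by (intro eventually_nhds_in_open) auto
  then have "eventually (\<lambda>z. eval_fps (Abs_fps c) z = eval_fps 0 z) (nhds 0)"
    by eventually_elim (use s in \<open>simp add: eval_fps_def sums_iff\<close>)
  then have "Abs_fps c = 0" by (intro eval_fps_eqD) (use r in auto)
  then show ?thesis by (metis fps_nth_Abs_fps fps_zero_nth)
qed

lemma bidisc_series_eq_0:
  assumes a: "square_summable a" and 0: "\<And>x. bidisc_series a x = 0"
  shows "a k = 0"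
proof -
  have row: "(\<lambda>j. a (i, j) * w ^ j) summable_on UNIV"
    if "w \<in> ball 0 1" for i w
  proof -
    have b: "(1/2, w) \<in> bidisc" using that by (simp add: bidisc_def norm_divide)
    have "(\<lambda>(i, j). a (i, j) * ((1/2) ^ i * w ^ j)) summable_on (Sigma UNIV (\<lambda>_. UNIV))"
      using bidisc_series_summable[OF a b] by simp
    from summable_on_Sigma_banach[OF this]
    have "(\<lambda>j. a (i, j) * ((1/2) ^ i * w ^ j)) summable_on UNIV"
      using summable_on_SigmaD1[of "\<lambda>i j. a (i, j) * ((1/2) ^ i * w ^ j)" UNIV "\<lambda>_. UNIV" i]
        bidisc_series_summable[OF a b] by simp
    then have "(\<lambda>j. 2 ^ i * (a (i, j) * ((1/2) ^ i * w ^ j))) summable_on UNIV"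
      by (rule summable_on_cmult_right)
    then show ?thesis by (simp add: field_simps)
  qed
  have "(\<Sum>\<^sub>\<infinity>j. a (i, j) * w ^ j) = 0" if w: "w \<in> ball 0 1" for i w
  proof (rule power_series_unique)
    fix z :: complex assume "z \<in> ball 0 1"
    then have b: "(z, w) \<in> bidisc" using w by (simp add: bidisc_def)
    have s: "(\<lambda>(i, j). a (i, j) * (z ^ i * w ^ j)) summable_on (Sigma UNIV (\<lambda>_. UNIV))"
      using bidisc_series_summable[OF a b] by simp
    have e: "(\<Sum>\<^sub>\<infinity>j. a (i, j) * (z ^ i * w ^ j)) = (\<Sum>\<^sub>\<infinity>j. a (i, j) * w ^ j) * z ^ i" for i
      by (simp add: mult.left_commute mult.commute flip: infsum_cmult_right')
    show "(\<lambda>i. (\<Sum>\<^sub>\<infinity>j. a (i, j) * w ^ j) * z ^ i) summable_on UNIV"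
      using summable_on_Sigma_banach[OF s] by (simp add: e)
    show "(\<Sum>\<^sub>\<infinity>i. (\<Sum>\<^sub>\<infinity>j. a (i, j) * w ^ j) * z ^ i) = 0"
      using infsum_Sigma'_banach[OF s] 0[of "(z, w)"] b by (simp add: e bidisc_series_def)
  qed
  then have "a (i, j) = 0" for i j
    using power_series_unique[of "\<lambda>j. a (i, j)" j] row by blast
  then show ?thesis by (cases k) simp
qed

lemma bidisc_series_inject:
  assumes "square_summable a" "square_summable b" "bidisc_series a = bidisc_series b"
  shows "a = b"
proof
  fix k
  have b: "square_summable (\<lambda>k. - 1 * b k)" by (rule square_summable_cmult) fact
  have "a k + - 1 * b k = 0"
  proof (rule bidisc_series_eq_0[where a = "\<lambda>k. a k + - 1 * b k"])
    show "square_summable (\<lambda>k. a k + - 1 * b k)"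
      by (rule square_summable_add) fact+
    show "bidisc_series (\<lambda>k. a k + - 1 * b k) x = 0" for x
      by (simp only: bidisc_series_add[OF assms(1) b] bidisc_series_cmult assms(3)) simp
  qed
  then show "a k = b k" by simp
qed

text \<open>\<open>H\<^sup>2\<close> of the bidisc: the functions on the bidisc whose Taylor coefficients at the
  origin are square summable.\<close>

typedef hardy2 = "{f. \<exists>a. square_summable a \<and> f = bidisc_series a}"
proof (rule exI[of _ "bidisc_series (\<lambda>_. 0)"], rule CollectI, rule exI[of _ "\<lambda>_. 0"])
qed (simp add: square_summable_def)

setup_lifting type_definition_hardy2

definition taylor :: "hardy2 \<Rightarrow> nat \<times> nat \<Rightarrow> complex" where
  "taylor f = (THE a. square_summable a \<and> Rep_hardy2 f = bidisc_series a)"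

lemma taylor_eqI:
  assumes "square_summable a" "Rep_hardy2 f = bidisc_series a"
  shows "taylor f = a"
  unfolding taylor_def
  by (rule the_equality) (use assms bidisc_series_inject in auto)

lemma taylor: "square_summable (taylor f)" "Rep_hardy2 f = bidisc_series (taylor f)"
  using Rep_hardy2[of f] taylor_eqI by auto

lemma taylor_inject: "taylor f = taylor g \<longleftrightarrow> f = g"
  by (metis Rep_hardy2_inject taylor(2))

definition cinner :: "hardy2 \<Rightarrow> hardy2 \<Rightarrow> complex" where
  "cinner f g = (\<Sum>\<^sub>\<infinity>k. taylor f k * cnj (taylor g k))"

lift_definition scaleC :: "complex \<Rightarrow> hardy2 \<Rightarrow> hardy2" is "\<lambda>c f x. c * f x"
proof clarify
  fix c a assume "square_summable a"
  then show "\<exists>b. square_summable b \<and> (\<lambda>x. c * bidisc_series a x) = bidisc_series b"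
    by (intro exI[of _ "\<lambda>k. c * a k"]) (simp add: square_summable_cmult bidisc_series_cmult)
qed

instantiation hardy2 :: real_inner
begin

lift_definition zero_hardy2 :: hardy2 is "\<lambda>_. 0"
  by (rule exI[of _ "\<lambda>_. 0"]) (simp add: square_summable_zero bidisc_series_zero)
lift_definition plus_hardy2 :: "hardy2 \<Rightarrow> hardy2 \<Rightarrow> hardy2" is "\<lambda>f g x. f x + g x"
proof clarify
  fix a b assume "square_summable a" "square_summable b"
  then show "\<exists>c. square_summable c \<and>
      (\<lambda>x. bidisc_series a x + bidisc_series b x) = bidisc_series c"
    by (intro exI[of _ "\<lambda>k. a k + b k"]) (simp add: square_summable_add bidisc_series_add)
qed
definition "uminus f = scaleC (- 1) f" for f :: hardy2
definition "f - g = f + - g" for f g :: hardy2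
definition "scaleR r f = scaleC (of_real r) f" for f :: hardy2
definition "inner f g = Re (cinner f g)" for f g :: hardy2
definition "norm f = sqrt (inner f f)" for f :: hardy2
definition "dist f g = norm (f - g)" for f g :: hardy2
definition "sgn f = scaleR (inverse (norm f)) f" for f :: hardy2
definition "(uniformity :: (hardy2 \<times> hardy2) filter) = (INF e\<in>{0 <..}. principal {(f, g). dist f g < e})"
definition "open U = (\<forall>f\<in>U. eventually (\<lambda>(f', g). f' = f \<longrightarrow> g \<in> U) uniformity)" for U :: "hardy2 set"

lemma taylor_zero: "taylor 0 = (\<lambda>_. 0)"
  by (rule taylor_eqI) (simp_all add: square_summable_zero bidisc_series_zero zero_hardy2.rep_eq)

lemma taylor_plus: "taylor (f + g) = (\<lambda>k. taylor f k + taylor g k)"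
proof (rule taylor_eqI)
  show "square_summable (\<lambda>k. taylor f k + taylor g k)"
    by (rule square_summable_add) (rule taylor)+
  show "Rep_hardy2 (f + g) = bidisc_series (\<lambda>k. taylor f k + taylor g k)"
    unfolding plus_hardy2.rep_eq bidisc_series_add[OF taylor(1) taylor(1)] taylor(2)[symmetric] ..
qed

lemma taylor_scaleC: "taylor (scaleC c f) = (\<lambda>k. c * taylor f k)"
proof (rule taylor_eqI)
  show "square_summable (\<lambda>k. c * taylor f k)"
    by (rule square_summable_cmult) (rule taylor)
  show "Rep_hardy2 (scaleC c f) = bidisc_series (\<lambda>k. c * taylor f k)"
    unfolding scaleC.rep_eq bidisc_series_cmult taylor(2)[symmetric] ..
qed

lemmas taylor_simps = taylor_zero taylor_plus taylor_scaleC

lemma cinner_summable: "(\<lambda>k. taylor f k * cnj (taylor g k)) summable_on UNIV"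
proof (rule abs_summable_summable)
  show "(\<lambda>k. norm (taylor f k * cnj (taylor g k))) summable_on UNIV"
    by (rule square_summable_abs_product) (simp_all only: square_summable_cnj taylor(1))
qed

lemma cinner_self: "cinner f f = of_real (\<Sum>\<^sub>\<infinity>k. (cmod (taylor f k))\<^sup>2)"
proof -
  have "((\<lambda>k. (cmod (taylor f k))\<^sup>2) has_sum (\<Sum>\<^sub>\<infinity>k. (cmod (taylor f k))\<^sup>2)) UNIV"
    using taylor(1)[of f] by (simp add: square_summable_def)
  then have "((\<lambda>k. of_real ((cmod (taylor f k))\<^sup>2))
      has_sum (of_real (\<Sum>\<^sub>\<infinity>k. (cmod (taylor f k))\<^sup>2) :: complex)) UNIV"
    by (simp only: has_sum_of_real_iff)
  then have "((\<lambda>k. taylor f k * cnj (taylor f k))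
      has_sum (of_real (\<Sum>\<^sub>\<infinity>k. (cmod (taylor f k))\<^sup>2) :: complex)) UNIV"
    by (simp only: complex_norm_square)
  then show ?thesis unfolding cinner_def by (rule infsumI)
qed

instance
proof
  fix x y z :: hardy2 and r s :: real
  show "x + y + z = x + (y + z)" "x + y = y + x" "0 + x = x" "- x + x = 0" "x - y = x + - y"
    "scaleR r (x + y) = scaleR r x + scaleR r y" "scaleR (r + s) x = scaleR r x + scaleR s x"
    "scaleR r (scaleR s x) = scaleR (r * s) x" "scaleR 1 x = x"
    unfolding taylor_inject[symmetric] uminus_hardy2_def minus_hardy2_def scaleR_hardy2_def
    by (auto simp: taylor_simps algebra_simps)
  show "inner x y = inner y x"
  proof -
    have "cinner x y = cnj (cinner y x)"
      unfolding cinner_def infsum_cnj[symmetric] by (simp add: mult.commute)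
    then show ?thesis by (simp add: inner_hardy2_def)
  qed
  show "inner (x + y) z = inner x z + inner y z"
    using infsum_add[OF cinner_summable[of x z] cinner_summable[of y z]]
    by (simp add: inner_hardy2_def cinner_def taylor_simps ring_distribs)
  show "inner (scaleR r x) y = r * inner x y"
    by (simp add: inner_hardy2_def cinner_def scaleR_hardy2_def taylor_simps mult.assoc
        infsum_cmult_right')
  show "0 \<le> inner x x"
    by (simp add: inner_hardy2_def cinner_self infsum_nonneg)
  show "inner x x = 0 \<longleftrightarrow> x = 0"
  proof
    assume "inner x x = 0"
    then have "(\<Sum>\<^sub>\<infinity>k. (cmod (taylor x k))\<^sup>2) = 0"
      by (simp add: inner_hardy2_def cinner_self)
    then have "(cmod (taylor x k))\<^sup>2 = 0" for k
      using taylor(1)[of x] unfolding square_summable_def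
      by (intro nonneg_infsum_le_0D[of "\<lambda>k. (cmod (taylor x k))\<^sup>2" UNIV]) auto
    then show "x = 0" by (simp add: taylor_zero fun_eq_iff flip: taylor_inject)
  qed (simp add: inner_hardy2_def cinner_def taylor_zero)
qed (rule norm_hardy2_def dist_hardy2_def sgn_hardy2_def uniformity_hardy2_def open_hardy2_def)+

end

interpretation hardy2: vector_space scaleC
  by unfold_locales
    (auto simp: taylor_simps algebra_simps simp flip: taylor_inject)

section \<open>Coordinate multiplications and polynomials\<close>

lemma bidisc_series_shift:
  fixes \<phi> :: "nat \<times> nat \<Rightarrow> nat \<times> nat" and a :: "nat \<times> nat \<Rightarrow> complex"
  assumes a: "square_summable a" and \<phi>: "inj \<phi>"
    and e: "\<And>z w i j. (\<lambda>(i, j). z ^ i * w ^ j) (\<phi> (i, j)) = m (z, w) * (z ^ i * w ^ j)"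
  shows "\<exists>b. square_summable b \<and> (\<lambda>x. m x * bidisc_series a x) = bidisc_series b"
proof (intro exI conjI)
  define b where "b = (\<lambda>k. if k \<in> range \<phi> then a (inv \<phi> k) else 0)"
  have b\<phi>: "b (\<phi> k) = a k" for k by (simp add: b_def \<phi>)
  have "((\<lambda>k. (cmod (b k))\<^sup>2) \<circ> \<phi>) summable_on UNIV"
    using a by (simp add: o_def b\<phi> square_summable_def)
  then have "(\<lambda>k. (cmod (b k))\<^sup>2) summable_on range \<phi>"
    by (simp add: summable_on_reindex[OF \<phi>])
  moreover have "(\<lambda>k. (cmod (b k))\<^sup>2) summable_on range \<phi> \<longleftrightarrow> (\<lambda>k. (cmod (b k))\<^sup>2) summable_on UNIV"
    by (rule summable_on_cong_neutral) (auto simp: b_def)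
  ultimately show "square_summable b" by (simp add: square_summable_def)
  show "(\<lambda>x. m x * bidisc_series a x) = bidisc_series b"
  proof
    fix x :: "complex \<times> complex"
    obtain z w where x: "x = (z, w)" by (cases x)
    have "(\<Sum>\<^sub>\<infinity>k. b k * (case k of (i, j) \<Rightarrow> z ^ i * w ^ j))
        = (\<Sum>\<^sub>\<infinity>k\<in>range \<phi>. b k * (case k of (i, j) \<Rightarrow> z ^ i * w ^ j))"
      by (rule infsum_cong_neutral) (auto simp: b_def)
    also have "\<dots> = (\<Sum>\<^sub>\<infinity>k. a k * (m (z, w) * (case k of (i, j) \<Rightarrow> z ^ i * w ^ j)))"
    proof -
      have "(case \<phi> k of (i, j) \<Rightarrow> z ^ i * w ^ j) = m (z, w) * (case k of (i, j) \<Rightarrow> z ^ i * w ^ j)" for k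
        using e[where z = z and w = w and i = "fst k" and j = "snd k"] by (simp add: case_prod_unfold)
      then show ?thesis
        by (simp add: infsum_reindex[OF \<phi>] o_def b\<phi>)
    qed
    also have "\<dots> = m (z, w) * (\<Sum>\<^sub>\<infinity>k. a k * (case k of (i, j) \<Rightarrow> z ^ i * w ^ j))"
      by (simp add: mult.left_commute flip: infsum_cmult_right')
    finally show "m x * bidisc_series a x = bidisc_series b x"
      by (simp add: x bidisc_series_def case_prod_unfold)
  qed
qed

lemma bidisc_series_mult_fst:
  assumes "square_summable a"
  shows "\<exists>b. square_summable b \<and> (\<lambda>x. fst x * bidisc_series a x) = bidisc_series b"
  by (rule bidisc_series_shift[OF assms, of "\<lambda>(i, j). (Suc i, j)"]) (auto simp: inj_def)

lemma bidisc_series_mult_snd: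
  assumes "square_summable a"
  shows "\<exists>b. square_summable b \<and> (\<lambda>x. snd x * bidisc_series a x) = bidisc_series b"
  by (rule bidisc_series_shift[OF assms, of "\<lambda>(i, j). (i, Suc j)"]) (auto simp: inj_def)

lift_definition mult_z :: "hardy2 \<Rightarrow> hardy2" is "\<lambda>f x. fst x * f x"
  using bidisc_series_mult_fst by blast

lift_definition mult_w :: "hardy2 \<Rightarrow> hardy2" is "\<lambda>f x. snd x * f x"
  using bidisc_series_mult_snd by blast

lift_definition const_hardy2 :: "complex \<Rightarrow> hardy2" is "\<lambda>c x. if x \<in> bidisc then c else 0"
proof (intro exI conjI)
  fix c :: complex
  let ?a = "\<lambda>k :: nat \<times> nat. if k = (0, 0) then c else 0"
  have "(\<lambda>k. (cmod (?a k))\<^sup>2) summable_on {(0, 0)} \<longleftrightarrow> (\<lambda>k. (cmod (?a k))\<^sup>2) summable_on UNIV"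
    by (rule summable_on_cong_neutral) auto
  then show "square_summable ?a" by (simp add: square_summable_def)
  have "(\<Sum>\<^sub>\<infinity>k. ?a k * (case k of (i, j) \<Rightarrow> z ^ i * w ^ j))
      = (\<Sum>\<^sub>\<infinity>k\<in>{(0, 0)}. ?a k * (case k of (i, j) \<Rightarrow> z ^ i * w ^ j))" for z w
    by (rule infsum_cong_neutral) auto
  then show "(\<lambda>x. if x \<in> bidisc then c else 0) = bidisc_series ?a"
    by (auto simp: bidisc_series_def case_prod_unfold fun_eq_iff prod_eq_iff)
qed

text \<open>\<open>\<complex>[z, w]\<close> is rendered as \<open>\<complex>[z][w]\<close>: the coefficient of \<open>z\<^sup>i w\<^sup>j\<close> in \<open>p\<close> is
  \<open>coeff (coeff p j) i\<close>.\<close>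

definition poly_zw :: "complex poly poly \<Rightarrow> complex \<Rightarrow> complex \<Rightarrow> complex" where
  "poly_zw p z w = poly (poly p [:w:]) z"

lift_definition poly_hardy2 :: "complex poly poly \<Rightarrow> hardy2"
  is "\<lambda>p (z, w). if (z, w) \<in> bidisc then poly_zw p z w else 0"
proof -
  fix p :: "complex poly poly"
  have c: "\<exists>h. \<forall>z w. Rep_hardy2 h (z, w) = (if (z, w) \<in> bidisc then poly c z else 0)" for c
  proof (induction c)
    case 0
    show ?case by (rule exI[of _ 0]) (simp add: zero_hardy2.rep_eq)
  next
    case (pCons d c)
    then obtain h where "\<forall>z w. Rep_hardy2 h (z, w) = (if (z, w) \<in> bidisc then poly c z else 0)"
      by blast
    then show ?case
      by (intro exI[of _ "const_hardy2 d + mult_z h"])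
        (auto simp: plus_hardy2.rep_eq const_hardy2.rep_eq mult_z.rep_eq)
  qed
  have "\<exists>h. \<forall>z w. Rep_hardy2 h (z, w) = (if (z, w) \<in> bidisc then poly_zw p z w else 0)"
  proof (induction p)
    case 0
    show ?case by (rule exI[of _ 0]) (simp add: zero_hardy2.rep_eq poly_zw_def)
  next
    case (pCons d p)
    then obtain h where h: "\<forall>z w. Rep_hardy2 h (z, w) = (if (z, w) \<in> bidisc then poly_zw p z w else 0)"
      by blast
    from c[of d] obtain g where
      "\<forall>z w. Rep_hardy2 g (z, w) = (if (z, w) \<in> bidisc then poly d z else 0)" by blast
    with h show ?case
      by (intro exI[of _ "g + mult_w h"])
        (auto simp: plus_hardy2.rep_eq mult_w.rep_eq poly_zw_def)
  qed
  then obtain h where h: "\<forall>z w. Rep_hardy2 h (z, w) = (if (z, w) \<in> bidisc then poly_zw p z w else 0)"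
    by blast
  have "(\<lambda>(z, w). if (z, w) \<in> bidisc then poly_zw p z w else 0) = Rep_hardy2 h"
    using h by (auto simp: fun_eq_iff)
  then show "\<exists>a. square_summable a \<and>
      (\<lambda>(z, w). if (z, w) \<in> bidisc then poly_zw p z w else 0) = bidisc_series a"
    using Rep_hardy2[of h] by simp
qed

definition homogeneous_of_degree :: "nat \<Rightarrow> complex poly poly \<Rightarrow> bool" where
  "homogeneous_of_degree d p \<longleftrightarrow> (\<forall>i j. coeff (coeff p j) i \<noteq> 0 \<longrightarrow> i + j = d)"

definition nonconstant_homogeneous :: "complex poly poly \<Rightarrow> bool" where
  "nonconstant_homogeneous p \<longleftrightarrow> p \<noteq> 0 \<and> (\<exists>d\<ge>1. homogeneous_of_degree d p)"

section \<open>Operators on closed subspaces\<close>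

text \<open>An operator on a closed subspace \<open>Q\<close> is represented by a function on the whole space of which
  only the values on \<open>Q\<close> matter.\<close>

definition ortho_complement :: "hardy2 set \<Rightarrow> hardy2 set" where
  "ortho_complement M = {f. \<forall>g\<in>M. cinner f g = 0}"

definition proj_on :: "hardy2 set \<Rightarrow> hardy2 \<Rightarrow> hardy2" where
  "proj_on Q f = (THE g. g \<in> Q \<and> f - g \<in> ortho_complement Q)"

definition compression :: "hardy2 set \<Rightarrow> (hardy2 \<Rightarrow> hardy2) \<Rightarrow> hardy2 \<Rightarrow> hardy2" where
  "compression Q T f = proj_on Q (T f)"

definition adjoint_on :: "hardy2 set \<Rightarrow> (hardy2 \<Rightarrow> hardy2) \<Rightarrow> hardy2 \<Rightarrow> hardy2" where
  "adjoint_on Q T g = (THE h. h \<in> Q \<and> (\<forall>f\<in>Q. cinner (T f) g = cinner f h))"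

definition orthonormal_basis :: "hardy2 set \<Rightarrow> hardy2 set \<Rightarrow> bool" where
  "orthonormal_basis Q E \<longleftrightarrow>
    (\<forall>e\<in>E. \<forall>f\<in>E. cinner e f = (if e = f then 1 else 0)) \<and> closure (hardy2.span E) = Q"

definition hilbert_schmidt_on :: "hardy2 set \<Rightarrow> (hardy2 \<Rightarrow> hardy2) \<Rightarrow> bool" where
  "hilbert_schmidt_on Q T \<longleftrightarrow>
    (\<forall>E. orthonormal_basis Q E \<longrightarrow> (\<lambda>e. (norm (T e))\<^sup>2) summable_on E)"

text \<open>For a bounded operator the value does not depend on the chosen orthonormal basis; it is
  meaningful only together with \<^const>\<open>hilbert_schmidt_on\<close>, since \<^const>\<open>infsum\<close> is \<open>0\<close> on
  families that are not summable.\<close>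

definition hs_norm_on :: "hardy2 set \<Rightarrow> (hardy2 \<Rightarrow> hardy2) \<Rightarrow> real" where
  "hs_norm_on Q T = sqrt (\<Sum>\<^sub>\<infinity>e\<in>(SOME E. orthonormal_basis Q E). (norm (T e))\<^sup>2)"

definition has_cdim :: "hardy2 set \<Rightarrow> nat \<Rightarrow> bool" where
  "has_cdim V d \<longleftrightarrow>
    (\<exists>B. finite B \<and> \<not> hardy2.dependent B \<and> hardy2.span B = V \<and> card B = d)"

text \<open>The sequence \<open>s\<close> lists, in some order, all non-zero singular values of the operator \<open>T\<close> on
  \<open>Q\<close>, each \<open>\<sigma>\<close> as often as the multiplicity \<open>dim ker (T\<^sup>* T - \<sigma>\<^sup>2)\<close> of the eigenvalue \<open>\<sigma>\<close> of
  \<open>(T\<^sup>* T)\<^sup>1\<^sup>/\<^sup>2\<close>. Finiteness of the level sets is demanded because \<^const>\<open>card\<close> is \<open>0\<close> on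
  infinite sets.\<close>

definition enumerates_nonzero_singular_values ::
    "hardy2 set \<Rightarrow> (hardy2 \<Rightarrow> hardy2) \<Rightarrow> (nat \<Rightarrow> real) \<Rightarrow> bool" where
  "enumerates_nonzero_singular_values Q T s \<longleftrightarrow>
    (\<forall>n. s n > 0) \<and>
    (\<forall>\<sigma>>0. finite {n. s n = \<sigma>} \<and>
      has_cdim {f \<in> Q. adjoint_on Q T (T f) = scaleC (of_real (\<sigma>\<^sup>2)) f} (card {n. s n = \<sigma>}))"

section \<open>Quotient modules\<close>

definition poly_submodule :: "complex poly poly \<Rightarrow> hardy2 set" where
  "poly_submodule p = closure (range (\<lambda>q. poly_hardy2 (p * q)))"

definition quotient_module :: "complex poly poly \<Rightarrow> hardy2 set" where
  "quotient_module p = ortho_complement (poly_submodule p)"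

definition S_z :: "complex poly poly \<Rightarrow> hardy2 \<Rightarrow> hardy2" where
  "S_z p = compression (quotient_module p) mult_z"

definition S_w :: "complex poly poly \<Rightarrow> hardy2 \<Rightarrow> hardy2" where
  "S_w p = compression (quotient_module p) mult_w"

definition cross_commutator :: "complex poly poly \<Rightarrow> hardy2 \<Rightarrow> hardy2" where
  "cross_commutator p f =
    adjoint_on (quotient_module p) (S_z p) (S_w p f) - S_w p (adjoint_on (quotient_module p) (S_z p) f)"

definition hs_norm_commutator :: "complex poly poly \<Rightarrow> real" where
  "hs_norm_commutator p = hs_norm_on (quotient_module p) (cross_commutator p)"

text \<open>\<open>(z - w)\<^sup>N\<close>: in \<open>\<complex>[z][w]\<close>, \<open>z\<close> is the constant \<open>[:[:0, 1:]:]\<close> and \<open>w\<close> is the outer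
  variable \<open>[:0, 1:]\<close>.\<close>

definition p_diag :: "nat \<Rightarrow> complex poly poly" where
  "p_diag N = ([:[:0, 1:]:] - [:0, 1:]) ^ N"

lemma poly_zw_p_diag: "poly_zw (p_diag N) z w = (z - w) ^ N"
  by (simp add: poly_zw_def p_diag_def)

definition t_coeff :: "nat \<Rightarrow> nat \<Rightarrow> real" where
  "t_coeff n N = (fact (n + N))\<^sup>2 / (fact n * fact (n + 2 * N))"

definition \<beta> :: "nat \<Rightarrow> nat \<Rightarrow> real" where
  "\<beta> n N = (if n = 0 then 1 - 1 / real ((2 * N) choose N)
            else real N / real (n + N) * (1 - t_coeff n N))"

end

theory Submission
  imports Defs
begin

text \<open>Let \<open>Q\<close> be the quotient module of \<open>p = (z - w)\<^sup>N\<close>. On \<open>Q\<close> the adjoint of \<open>S\<^sub>z\<close> is the backward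
  shift, and for \<open>f \<in> Q\<close> the function \<open>w f\<close> is orthogonal to \<open>w [p]\<close>. Hence the projection of
  \<open>w f\<close> to \<open>[p]\<close> only involves \<open>[p] \<ominus> w [p]\<close>, which has one dimension in each degree \<open>n + N\<close>,
  spanned by \<open>U\<^sub>n = p \<Sum>\<^sub>j g\<^sub>j z\<^bsup>n - j\<^esup> w\<^sup>j\<close>, where the \<open>g\<^sub>j\<close> are the coefficients of the (reversed)
  orthogonal polynomial on the circle for the weight \<open>\<bar>1 - x\<bar>\<^bsup>2 N\<^esup>\<close>. So the commutator maps the part
  of degree \<open>n + N - 1\<close> to itself with rank one: it is \<open>f \<mapsto> \<Sum>\<^sub>n \<langle>f, A\<^sub>n\<rangle> B\<^sub>n\<close> with two orthogonal
  families, and its singular values are the products of the norms of \<open>A\<^sub>n\<close> and \<open>B\<^sub>n\<close>. These follow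
  from \<open>\<parallel>U\<^sub>n\<parallel>\<^sup>2 = 1 / t\<^sub>n\<close> and the two extreme Taylor coefficients of \<open>U\<^sub>n\<close>. The bounds come from
  comparing \<open>\<Sum>\<^sub>n (N / (n + N))\<^sup>2\<close> with a telescoping sum.\<close>

section \<open>The inner product of the Hardy space\<close>

text \<open>In degree \<open>n + N\<close>, multiples of p are p times a form of degree n. With x =
  w/z their inner products are those of polynomials on the circle for the weight |1 - x|^(2N), and
  multiplication by w becomes multiplication by x. So orthogonality to w [p] means orthogonality to
  x, ..., x^n, which defines the reversed orthogonal polynomial. Since the backward shift in z
  commutes with multiplication by w, the terms w back_z f cancel in the commutator, and what remains
  is the difference of two projections to [p], each a series over the U_n. Both z U_(n-1) and U_n
  differ from z^n p by an element of w [p]; hence the coefficient of U_(n-1) in one series and that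
  of U_n in the other come from the same functional of f. This is why each degree has rank one. The
  limit 1 is the integral of 1/(1 + x)^2 over x > 0: the sum of (N/(n + N))^2, divided by N, is a
  Riemann sum for it, and t_n is uniformly small for n <= K N as N grows.\<close>

lemma cinner_add_left: "cinner (x + y) z = cinner x z + cinner y z"
  using infsum_add[OF cinner_summable[of x z] cinner_summable[of y z]]
  by (simp add: cinner_def taylor_simps ring_distribs)

lemma cinner_scaleC_left: "cinner (scaleC c x) y = c * cinner x y"
  by (simp add: cinner_def taylor_simps mult.assoc infsum_cmult_right')

lemma cinner_commute: "cinner x y = cnj (cinner y x)"
  by (simp add: cinner_def mult.commute flip: infsum_cnj)

lemma cinner_add_right: "cinner x (y + z) = cinner x y + cinner x z"
  by (metis cinner_add_left cinner_commute complex_cnj_add)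

lemma cinner_scaleC_right: "cinner x (scaleC c y) = cnj c * cinner x y"
  by (metis cinner_commute cinner_scaleC_left complex_cnj_mult)

lemma cinner_zero [simp]: "cinner 0 x = 0" "cinner x 0 = 0"
  by (simp_all add: cinner_def taylor_zero)

lemma cinner_minus_left: "cinner (- x) y = - cinner x y"
  unfolding uminus_hardy2_def cinner_scaleC_left by simp

lemma cinner_minus_right: "cinner x (- y) = - cinner x y"
  unfolding uminus_hardy2_def cinner_scaleC_right by simp

lemma cinner_diff_left: "cinner (x - y) z = cinner x z - cinner y z"
  using cinner_add_left[of x "- y" z] by (simp add: cinner_minus_left)

lemma cinner_diff_right: "cinner x (y - z) = cinner x y - cinner x z"
  using cinner_add_right[of x y "- z"] by (simp add: cinner_minus_right)

lemma cinner_sum_left: "cinner (sum f S) y = (\<Sum>i\<in>S. cinner (f i) y)"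
  by (induction S rule: infinite_finite_induct) (simp_all add: cinner_add_left)

lemma cinner_sum_right: "cinner y (sum f S) = (\<Sum>i\<in>S. cinner y (f i))"
  by (induction S rule: infinite_finite_induct) (simp_all add: cinner_add_right)

lemmas cinner_simps =
  cinner_add_left cinner_add_right cinner_diff_left cinner_diff_right cinner_minus_left
  cinner_minus_right cinner_scaleC_left cinner_scaleC_right cinner_sum_left cinner_sum_right

lemma inner_eq_Re_cinner: "inner x y = Re (cinner x y)" for x y :: hardy2
  by (simp add: inner_hardy2_def)

lemma cinner_self_norm: "cinner f f = of_real ((norm f)\<^sup>2)"
proof -
  have "Re (cinner f f) = (norm f)\<^sup>2"
    by (simp add: norm_eq_sqrt_inner flip: inner_eq_Re_cinner)
  then show ?thesis
    using cinner_self[of f] by (metis Re_complex_of_real)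
qed

lemma norm_sq_eq_infsum: "(norm f)\<^sup>2 = (\<Sum>\<^sub>\<infinity>k. (cmod (taylor f k))\<^sup>2)"
  using cinner_self cinner_self_norm by (metis of_real_eq_iff)

lemma cinner_eq_0_commute: "cinner x y = 0 \<longleftrightarrow> cinner y x = 0"
  by (metis cinner_commute complex_cnj_zero)

lemma norm_scaleC: "norm (scaleC c x) = cmod c * norm x"
proof -
  have "complex_of_real ((norm (scaleC c x))\<^sup>2) = (c * cnj c) * of_real ((norm x)\<^sup>2)"
    by (simp only: cinner_self_norm[symmetric] cinner_simps mult.assoc mult.left_commute)
  also have "\<dots> = of_real ((cmod c * norm x)\<^sup>2)"
    by (simp only: complex_norm_square[symmetric] of_real_mult of_real_power power_mult_distrib)
  finally have "(norm (scaleC c x))\<^sup>2 = (cmod c * norm x)\<^sup>2"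
    using of_real_eq_iff by blast
  then show ?thesis by simp
qed

lemma scaleR_eq_scaleC: "scaleR r x = scaleC (of_real r) x"
  by (simp add: scaleR_hardy2_def)

text \<open>Multiplying \<open>x\<close> by the conjugate phase of the inner product makes that
  product real and nonnegative, so the Cauchy-Schwarz inequality of the real inner product
  applies.\<close>

lemma cinner_bound: "cmod (cinner x y) \<le> norm x * norm y"
proof (cases "cinner x y = 0")
  case False
  define u where "u = cnj (sgn (cinner x y))"
  have u: "cmod u = 1" using False by (simp add: u_def norm_sgn)
  have "cinner (scaleC u x) y = of_real (cmod (cinner x y))"
    using False by (simp add: cinner_simps u_def sgn_eq complex_norm_square[symmetric] power2_eq_square
        field_simps)
  then have "cmod (cinner x y) = inner (scaleC u x) y"
    by (simp add: inner_eq_Re_cinner)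
  also have "\<dots> \<le> norm (scaleC u x) * norm y"
    by (rule norm_cauchy_schwarz)
  finally show ?thesis by (simp add: norm_scaleC u)
qed simp

lemma bounded_linear_cinner_left: "bounded_linear (\<lambda>x. cinner x y)"
  by (rule bounded_linear_intro[of _ "norm y"])
    (simp_all add: cinner_simps scaleR_eq_scaleC cinner_bound scaleR_conv_of_real)

lemma bounded_linear_cinner_right: "bounded_linear (\<lambda>y. cinner x y)"
  by (rule bounded_linear_intro[of _ "norm x"])
    (use cinner_bound[of x] in
      \<open>simp_all add: cinner_simps scaleR_eq_scaleC scaleR_conv_of_real mult.commute\<close>)

lemma sums_cinner_left: "F sums s \<Longrightarrow> (\<lambda>n. cinner (F n) y) sums cinner s y"
  by (rule bounded_linear.sums[OF bounded_linear_cinner_left])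

lemma sums_cinner_right: "F sums s \<Longrightarrow> (\<lambda>n. cinner y (F n)) sums cinner y s"
  by (rule bounded_linear.sums[OF bounded_linear_cinner_right])

lemma continuous_on_cinner_left: "continuous_on S (\<lambda>x. cinner x y)"
  by (intro linear_continuous_on bounded_linear_cinner_left)

lemma continuous_on_cinner_right: "continuous_on S (\<lambda>y. cinner x y)"
  by (intro linear_continuous_on bounded_linear_cinner_right)

section \<open>Completeness of the Hardy space\<close>

definition of_taylor :: "(nat \<times> nat \<Rightarrow> complex) \<Rightarrow> hardy2" where
  "of_taylor a = Abs_hardy2 (bidisc_series a)"

lemma taylor_of_taylor: "square_summable a \<Longrightarrow> taylor (of_taylor a) = a"
  unfolding of_taylor_def by (rule taylor_eqI) (auto intro: Abs_hardy2_inverse)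

lemma taylor_diff: "taylor (f - g) = (\<lambda>k. taylor f k - taylor g k)"
  unfolding minus_hardy2_def uminus_hardy2_def taylor_simps by simp

lemma sum_taylor_le_norm:
  assumes "finite F"
  shows "(\<Sum>k\<in>F. (cmod (taylor f k))\<^sup>2) \<le> (norm f)\<^sup>2"
  unfolding norm_sq_eq_infsum
  by (rule finite_sum_le_infsum) (use assms taylor(1)[of f] in \<open>auto simp: square_summable_def\<close>)

lemma cmod_taylor_le_norm: "cmod (taylor f k) \<le> norm f"
  using sum_taylor_le_norm[of "{k}" f] by (simp add: power2_le_iff_abs_le)

text \<open>The argument for l^2: Taylor coefficients converge one by one, and the Cauchy bound on
  finite partial sums is uniform in the finite set, so it survives the limit. Completeness supplies
  projections and limits of orthogonal series.\<close>

instance hardy2 :: banach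
proof
  fix X :: "nat \<Rightarrow> hardy2"
  assume X: "Cauchy X"
  have "Cauchy (\<lambda>n. taylor (X n) k)" for k
  proof (rule CauchyI)
    fix e :: real assume "e > 0"
    then obtain M where M: "\<And>m n. m \<ge> M \<Longrightarrow> n \<ge> M \<Longrightarrow> norm (X m - X n) < e"
      using CauchyD[OF X] by blast
    then have "norm (taylor (X m) k - taylor (X n) k) < e" if "m \<ge> M" "n \<ge> M" for m n
      using cmod_taylor_le_norm[of "X m - X n" k] that by (fastforce simp: taylor_diff)
    then show "\<exists>M. \<forall>m\<ge>M. \<forall>n\<ge>M. norm (taylor (X m) k - taylor (X n) k) < e" by blast
  qed
  then have "\<forall>k. \<exists>l. (\<lambda>n. taylor (X n) k) \<longlonglongrightarrow> l"
    using Cauchy_convergent unfolding convergent_def by blast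
  then obtain a where a: "\<And>k. (\<lambda>n. taylor (X n) k) \<longlonglongrightarrow> a k"
    by metis
  have tail: "\<exists>M. \<forall>m\<ge>M. square_summable (\<lambda>k. taylor (X m) k - a k) \<and>
    (\<Sum>\<^sub>\<infinity>k. (cmod (taylor (X m) k - a k))\<^sup>2) \<le> e\<^sup>2" if e: "e > 0" for e
  proof -
    obtain M where M: "\<And>m n. m \<ge> M \<Longrightarrow> n \<ge> M \<Longrightarrow> norm (X m - X n) < e"
      using CauchyD[OF X e] by blast
    have fin: "(\<Sum>k\<in>F. (cmod (taylor (X m) k - a k))\<^sup>2) \<le> e\<^sup>2" if "m \<ge> M" "finite F" for m F
    proof (rule LIMSEQ_le_const2)
      show "(\<lambda>n. \<Sum>k\<in>F. (cmod (taylor (X m) k - taylor (X n) k))\<^sup>2)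
        \<longlonglongrightarrow> (\<Sum>k\<in>F. (cmod (taylor (X m) k - a k))\<^sup>2)"
        by (intro tendsto_intros a)
      have "(\<Sum>k\<in>F. (cmod (taylor (X m) k - taylor (X n) k))\<^sup>2) \<le> e\<^sup>2" if "n \<ge> M" for n
      proof -
        have "(\<Sum>k\<in>F. (cmod (taylor (X m) k - taylor (X n) k))\<^sup>2) \<le> (norm (X m - X n))\<^sup>2"
          using sum_taylor_le_norm[OF \<open>finite F\<close>, of "X m - X n"] by (simp add: taylor_diff)
        also have "\<dots> \<le> e\<^sup>2"
          using M[OF \<open>m \<ge> M\<close> that] by (intro power_mono) auto
        finally show ?thesis .
      qed
      then show "\<exists>N. \<forall>n\<ge>N. (\<Sum>k\<in>F. (cmod (taylor (X m) k - taylor (X n) k))\<^sup>2) \<le> e\<^sup>2"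
        by blast
    qed
    show ?thesis
    proof (intro exI allI impI conjI)
      fix m assume m: "m \<ge> M"
      show s: "square_summable (\<lambda>k. taylor (X m) k - a k)"
        unfolding square_summable_def
      proof (rule nonneg_bdd_above_summable_on)
        show "bdd_above (sum (\<lambda>k. (cmod (taylor (X m) k - a k))\<^sup>2) ` {F. F \<subseteq> UNIV \<and> finite F})"
          by (rule bdd_aboveI[of _ "e\<^sup>2"]) (use fin[OF m] in auto)
      qed auto
      then show "(\<Sum>\<^sub>\<infinity>k. (cmod (taylor (X m) k - a k))\<^sup>2) \<le> e\<^sup>2"
        by (intro infsum_le_finite_sums) (use fin[OF m] in \<open>auto simp: square_summable_def\<close>)
    qed
  qed
  obtain m where m: "square_summable (\<lambda>k. taylor (X m) k - a k)"
    using tail[of 1] by auto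
  have "square_summable (\<lambda>k. taylor (X m) k + (- 1) * (taylor (X m) k - a k))"
    by (intro square_summable_add square_summable_cmult m taylor)
  then have "square_summable a" by simp
  then have ta: "taylor (of_taylor a) = a" by (rule taylor_of_taylor)
  have "X \<longlonglongrightarrow> of_taylor a"
  proof (rule LIMSEQ_I)
    fix r :: real assume r: "r > 0"
    then obtain M where M: "\<And>m. m \<ge> M \<Longrightarrow> (\<Sum>\<^sub>\<infinity>k. (cmod (taylor (X m) k - a k))\<^sup>2) \<le> (r / 2)\<^sup>2"
      using tail[OF half_gt_zero[OF r]] by blast
    have "norm (X m - of_taylor a) < r" if "m \<ge> M" for m
    proof -
      have "(norm (X m - of_taylor a))\<^sup>2 \<le> (r / 2)\<^sup>2"
        unfolding norm_sq_eq_infsum taylor_diff ta by (rule M[OF that])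
      then have "norm (X m - of_taylor a) \<le> r / 2"
        by (rule power2_le_imp_le) (use r in simp)
      then show ?thesis using r by simp
    qed
    then show "\<exists>no. \<forall>n\<ge>no. norm (X n - of_taylor a) < r" by blast
  qed
  then show "convergent X" by (rule convergentI)
qed

section \<open>Closed subspaces\<close>

lemma subspace_ortho_complement: "hardy2.subspace (ortho_complement M)"
  by (auto simp: hardy2.subspace_def ortho_complement_def cinner_simps)

lemma closed_ortho_complement: "closed (ortho_complement M)"
proof -
  have "ortho_complement M = (\<Inter>g\<in>M. (\<lambda>f. cinner f g) -` {0})"
    by (auto simp: ortho_complement_def)
  then show ?thesis
    by (auto intro!: closed_INT closed_vimage continuous_on_cinner_left)
qed

lemma orthogonal_span:
  assumes "\<And>g. g \<in> B \<Longrightarrow> cinner f g = 0" "x \<in> hardy2.span B"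
  shows "cinner f x = 0"
  using assms(2) by (induction rule: hardy2.span_induct_alt) (simp_all add: cinner_simps assms(1))

lemma orthogonal_closure:
  assumes "\<And>g. g \<in> B \<Longrightarrow> cinner f g = 0" "x \<in> closure B"
  shows "cinner f x = 0"
proof -
  have "B \<subseteq> cinner f -` {0}" using assms(1) by auto
  then have "closure B \<subseteq> cinner f -` {0}"
    by (rule closure_minimal) (intro closed_vimage continuous_on_cinner_right closed_singleton)
  then show ?thesis using assms(2) by auto
qed

lemma parallelogram_identity:
  "(norm (x + y))\<^sup>2 + (norm (x - y))\<^sup>2 = 2 * (norm x)\<^sup>2 + 2 * (norm y)\<^sup>2" for x y :: "'a::real_inner"
  by (simp add: power2_norm_eq_inner inner_simps)

text \<open>A minimising sequence for the distance is Cauchy by the parallelogram identity, and its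
  limit is the projection. The variation argument is real and is carried over to the complex inner
  product at the end.\<close>

lemma projection_exists:
  assumes S: "hardy2.subspace S" "closed S"
  shows "\<exists>g\<in>S. \<forall>h\<in>S. cinner (f - g) h = 0"
proof -
  have ne: "S \<noteq> {}" using S(1) by (auto simp: hardy2.subspace_def)
  define d where "d = infdist f S"
  have d0: "d \<ge> 0" by (simp add: d_def infdist_nonneg)
  have dle: "d \<le> norm (f - g)" if "g \<in> S" for g
    using infdist_le[OF that, of f] by (simp add: d_def dist_norm)
  have "\<exists>g\<in>S. norm (f - g) < d + 1 / real (Suc n)" for n
  proof (rule ccontr)
    assume "\<not> ?thesis"
    then have "d + 1 / real (Suc n) \<le> (INF g\<in>S. dist f g)"
      using ne by (intro cINF_greatest) (auto simp: dist_norm not_less)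
    then show False using ne by (simp add: d_def infdist_def)
  qed
  then obtain g where g: "\<And>n. g n \<in> S" "\<And>n. norm (f - g n) < d + 1 / real (Suc n)"
    by metis
  have lim: "(\<lambda>n. 4 * ((d + 1 / real (Suc n))\<^sup>2 - d\<^sup>2)) \<longlonglongrightarrow> 4 * ((d + 0)\<^sup>2 - d\<^sup>2)"
    by (intro tendsto_intros lim_1_over_n[THEN LIMSEQ_Suc])
  have close: "(norm (g m - g n))\<^sup>2 \<le> 4 * ((d + 1 / real (Suc k))\<^sup>2 - d\<^sup>2)"
    if "m \<ge> k" "n \<ge> k" for m n k
  proof -
    have le: "(norm (f - g i))\<^sup>2 \<le> (d + 1 / real (Suc k))\<^sup>2" if "i \<ge> k" for i
    proof (rule power_mono)
      have "1 / real (Suc i) \<le> 1 / real (Suc k)" using that by (simp add: field_simps)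
      then show "norm (f - g i) \<le> d + 1 / real (Suc k)" using g(2)[of i] by linarith
    qed simp
    \<comment> \<open>The midpoint lies in \<open>S\<close>, so it is at distance at least
      \<open>d\<close> from \<open>f\<close>; this bounds the sum term of the parallelogram identity
      from below.\<close>
    have "scaleR (1/2) (g m + g n) \<in> S"
      using g(1) S(1) by (simp add: scaleR_eq_scaleC hardy2.subspace_def)
    then have "d \<le> norm (f - scaleR (1/2) (g m + g n))" by (rule dle)
    moreover have "(f - g m) + (f - g n) = scaleR 2 (f - scaleR (1/2) (g m + g n))"
      by (simp add: algebra_simps scaleR_2)
    ultimately have "2 * d \<le> norm ((f - g m) + (f - g n))" by simp
    then have "(2 * d)\<^sup>2 \<le> (norm ((f - g m) + (f - g n)))\<^sup>2"
      using d0 by (intro power_mono) auto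
    moreover have "(norm ((f - g m) - (f - g n)))\<^sup>2 = (norm (g m - g n))\<^sup>2"
      by (simp add: norm_minus_commute)
    ultimately show ?thesis
      using parallelogram_identity[of "f - g m" "f - g n"] le[OF that(1)] le[OF that(2)]
      by (simp add: power_mult_distrib)
  qed
  have "Cauchy g"
  proof (rule CauchyI)
    fix e :: real assume e: "e > 0"
    have "eventually (\<lambda>n. 4 * ((d + 1 / real (Suc n))\<^sup>2 - d\<^sup>2) < e\<^sup>2) sequentially"
      by (rule order_tendstoD[OF lim]) (use e in simp)
    then obtain k where k: "4 * ((d + 1 / real (Suc k))\<^sup>2 - d\<^sup>2) < e\<^sup>2"
      unfolding eventually_sequentially by blast
    have "norm (g m - g n) < e" if "m \<ge> k" "n \<ge> k" for m n
      by (rule power_less_imp_less_base[OF le_less_trans[OF close[OF that] k]]) (use e in simp)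
    then show "\<exists>M. \<forall>m\<ge>M. \<forall>n\<ge>M. norm (g m - g n) < e" by blast
  qed
  then obtain p where p: "g \<longlonglongrightarrow> p"
    using Cauchy_convergent[of g] unfolding convergent_def by blast
  have pS: "p \<in> S" using closed_sequentially[OF S(2) _ p] g(1) by blast
  have "norm (f - p) \<le> d"
  proof (rule LIMSEQ_le)
    show "(\<lambda>n. norm (f - g n)) \<longlonglongrightarrow> norm (f - p)" by (intro tendsto_intros p)
    show "(\<lambda>n. d + 1 / real (Suc n)) \<longlonglongrightarrow> d"
      using LIMSEQ_inverse_real_of_nat_add[of d] by (simp add: inverse_eq_divide)
    show "\<exists>N. \<forall>n\<ge>N. norm (f - g n) \<le> d + 1 / real (Suc n)" by (intro exI[of _ 0] allI impI less_imp_le g(2))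
  qed
  have orth: "inner (f - p) h = 0" if h: "h \<in> S" for h
  proof (cases "h = 0")
    case False
    \<comment> \<open>The minimiser of the quadratic polynomial
      \<open>(norm ((f - p) - scaleR t h))^2\<close> in \<open>t\<close>.\<close>
    define t where "t = inner (f - p) h / (norm h)\<^sup>2"
    have "p + scaleR t h \<in> S"
      using pS h S(1) by (simp add: scaleR_eq_scaleC hardy2.subspace_def)
    then have "norm (f - p) \<le> norm (f - (p + scaleR t h))"
      using dle \<open>norm (f - p) \<le> d\<close> by force
    then have "(norm (f - p))\<^sup>2 \<le> (norm ((f - p) - scaleR t h))\<^sup>2"
      by (intro power_mono) (auto simp: algebra_simps)
    also have "\<dots> = (norm (f - p))\<^sup>2 - 2 * t * inner (f - p) h + t\<^sup>2 * (norm h)\<^sup>2"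
      unfolding power2_norm_eq_inner
      by (simp add: inner_diff_left inner_diff_right inner_commute power2_eq_square algebra_simps)
    also have "\<dots> = (norm (f - p))\<^sup>2 - (inner (f - p) h)\<^sup>2 / (norm h)\<^sup>2"
      using False by (simp add: t_def power2_eq_square)
    finally have "(inner (f - p) h)\<^sup>2 / (norm h)\<^sup>2 \<le> 0" by simp
    then show ?thesis using False by (simp add: divide_le_0_iff)
  qed simp
  have "cinner (f - p) h = 0" if h: "h \<in> S" for h
  proof (rule complex_eqI)
    show "Re (cinner (f - p) h) = Re 0" using orth[OF h] by (simp add: inner_eq_Re_cinner)
    \<comment> \<open>The real part of the inner product with \<open>i h\<close> is the imaginary
      part of that with \<open>h\<close>.\<close>
    have "scaleC \<i> h \<in> S" using h S(1) by (simp add: hardy2.subspace_def)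
    from orth[OF this] show "Im (cinner (f - p) h) = Im 0"
      by (simp add: inner_eq_Re_cinner cinner_simps)
  qed
  then show ?thesis using pS by blast
qed

text \<open>Supplies the uniqueness behind both definite descriptions, \<open>proj_on\<close> and
  \<open>adjoint_on\<close>.\<close>

lemma orthogonal_mem_unique:
  assumes "hardy2.subspace S" "g \<in> S" "h \<in> S" "\<And>x. x \<in> S \<Longrightarrow> cinner x g = cinner x h"
  shows "g = h"
proof -
  have "g - h \<in> S" using assms(1-3) by (rule hardy2.subspace_diff)
  then have "cinner (g - h) (g - h) = 0"
    using assms(4)[of "g - h"] by (simp add: cinner_diff_right)
  then show ?thesis by (simp add: cinner_self_norm)
qed

lemma proj_on_eqI:
  assumes "hardy2.subspace S" "g \<in> S" "\<And>h. h \<in> S \<Longrightarrow> cinner (f - g) h = 0"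
  shows "proj_on S f = g"
  unfolding proj_on_def
proof (rule the_equality)
  show "g \<in> S \<and> f - g \<in> ortho_complement S"
    using assms by (auto simp: ortho_complement_def)
  fix g' assume "g' \<in> S \<and> f - g' \<in> ortho_complement S"
  then have g': "g' \<in> S" "\<And>h. h \<in> S \<Longrightarrow> cinner (f - g') h = 0"
    by (auto simp: ortho_complement_def)
  show "g' = g"
  proof (rule orthogonal_mem_unique[OF assms(1) g'(1) assms(2)])
    fix x assume "x \<in> S"
    then have "cinner g' x = cinner g x"
      using g'(2)[of x] assms(3)[of x] by (simp add: cinner_diff_left)
    then show "cinner x g' = cinner x g" by (metis cinner_commute)
  qed
qed

lemma proj_on:
  assumes "hardy2.subspace S" "closed S"
  shows "proj_on S f \<in> S" "\<And>h. h \<in> S \<Longrightarrow> cinner (proj_on S f) h = cinner f h"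
proof -
  obtain g where g: "g \<in> S" "\<And>h. h \<in> S \<Longrightarrow> cinner (f - g) h = 0"
    using projection_exists[OF assms] by blast
  then have "proj_on S f = g" by (rule proj_on_eqI[OF assms(1)])
  then show "proj_on S f \<in> S" "\<And>h. h \<in> S \<Longrightarrow> cinner (proj_on S f) h = cinner f h"
    using g by (auto simp: cinner_diff_left)
qed

lemma adjoint_on_eqI:
  assumes "hardy2.subspace S" "h \<in> S" "\<And>f. f \<in> S \<Longrightarrow> cinner (T f) g = cinner f h"
  shows "adjoint_on S T g = h"
  unfolding adjoint_on_def
  by (rule the_equality) (use assms in \<open>auto intro!: orthogonal_mem_unique[OF assms(1)]\<close>)

section \<open>Orthogonal families and orthonormal bases\<close>

lemma norm_sq_add_orthogonal:
  assumes "cinner x y = 0"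
  shows "(norm (x + y))\<^sup>2 = (norm x)\<^sup>2 + (norm y)\<^sup>2"
  using assms inner_eq_Re_cinner[of x y] by (simp add: power2_norm_eq_inner inner_simps inner_commute)

lemma norm_sq_sum_orthogonal:
  assumes "finite I" "\<And>i j. i \<in> I \<Longrightarrow> j \<in> I \<Longrightarrow> i \<noteq> j \<Longrightarrow> cinner (F i) (F j) = 0"
  shows "(norm (sum F I))\<^sup>2 = (\<Sum>i\<in>I. (norm (F i))\<^sup>2)"
  using assms
proof (induction I rule: finite_induct)
  case (insert x I)
  have "cinner (F x) (sum F I) = 0"
    unfolding cinner_sum_right by (rule sum.neutral) (use insert in auto)
  then show ?case using insert by (simp add: norm_sq_add_orthogonal)
qed simp

text \<open>The family stays unnormalised because the norms of the vectors are what is computed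
  later. The sum is the squared norm of the projection \<open>g\<close> of \<open>f\<close> to the
  span, and \<open>f - g\<close> is orthogonal to \<open>g\<close>.\<close>

lemma bessel_inequality:
  assumes "finite I" "\<And>i j. i \<in> I \<Longrightarrow> j \<in> I \<Longrightarrow> i \<noteq> j \<Longrightarrow> cinner (A i) (A j) = 0"
    and "\<And>i. i \<in> I \<Longrightarrow> A i \<noteq> 0"
  shows "(\<Sum>i\<in>I. (cmod (cinner f (A i)))\<^sup>2 / (norm (A i))\<^sup>2) \<le> (norm f)\<^sup>2"
proof -
  define c where "c i = cinner f (A i) / of_real ((norm (A i))\<^sup>2)" for i
  define g where "g = (\<Sum>i\<in>I. scaleC (c i) (A i))"
  have "cinner g (A j) = cinner f (A j)" if j: "j \<in> I" for j
  proof -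
    have "cinner g (A j) = (\<Sum>i\<in>I. if i = j then c j * of_real ((norm (A j))\<^sup>2) else 0)"
      unfolding g_def cinner_sum_left cinner_scaleC_left
      by (rule sum.cong) (use assms(2) j in \<open>auto simp: cinner_self_norm\<close>)
    also have "\<dots> = cinner f (A j)"
      using j assms(1,3) by (simp add: c_def)
    finally show ?thesis .
  qed
  then have "cinner (f - g) g = 0"
    by (subst (2) g_def) (simp add: cinner_sum_right cinner_scaleC_right cinner_diff_left)
  then have "(norm f)\<^sup>2 = (norm (f - g))\<^sup>2 + (norm g)\<^sup>2"
    using norm_sq_add_orthogonal[of "f - g" g] by simp
  moreover have "(norm g)\<^sup>2 = (\<Sum>i\<in>I. (norm (scaleC (c i) (A i)))\<^sup>2)"
    unfolding g_def
    by (rule norm_sq_sum_orthogonal) (use assms in \<open>auto simp: cinner_scaleC_left cinner_scaleC_right\<close>)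
  moreover have "\<dots> = (\<Sum>i\<in>I. (cmod (cinner f (A i)))\<^sup>2 / (norm (A i))\<^sup>2)"
    by (rule sum.cong)
      (use assms(3) in \<open>auto simp: norm_scaleC c_def norm_divide norm_mult power2_eq_square\<close>)
  ultimately show ?thesis using zero_le_power2[of "norm (f - g)"] by linarith
qed

lemma summable_bessel:
  fixes A :: "nat \<Rightarrow> hardy2"
  assumes "\<And>i j. i \<noteq> j \<Longrightarrow> cinner (A i) (A j) = 0" "\<And>i. A i \<noteq> 0"
  shows "summable (\<lambda>i. (cmod (cinner f (A i)))\<^sup>2 / (norm (A i))\<^sup>2)"
  by (rule summableI_nonneg_bounded[of _ "(norm f)\<^sup>2"])
    (use assms in \<open>auto intro!: bessel_inequality\<close>)

text \<open>By Pythagoras, the Cauchy criterion for the series is the one for the squared norms;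
  completeness does the rest.\<close>

lemma summable_orthogonal:
  fixes F :: "nat \<Rightarrow> hardy2"
  assumes orth: "\<And>i j. i \<noteq> j \<Longrightarrow> cinner (F i) (F j) = 0" and s: "summable (\<lambda>n. (norm (F n))\<^sup>2)"
  shows "summable F"
  unfolding summable_Cauchy
proof (intro allI impI)
  fix e :: real assume e: "e > 0"
  then obtain N where N: "\<And>m n. m \<ge> N \<Longrightarrow> norm (\<Sum>k\<in>{m..<n}. (norm (F k))\<^sup>2) < e\<^sup>2"
    using s unfolding summable_Cauchy by (meson zero_less_power)
  have "norm (sum F {m..<n}) < e" if "m \<ge> N" for m n
  proof (rule power_less_imp_less_base[of _ 2])
    have "(norm (sum F {m..<n}))\<^sup>2 = (\<Sum>k\<in>{m..<n}. (norm (F k))\<^sup>2)"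
      by (rule norm_sq_sum_orthogonal) (use orth in auto)
    also have "\<dots> < e\<^sup>2" using N[OF that, of n] by (simp add: sum_nonneg)
    finally show "(norm (sum F {m..<n}))\<^sup>2 < e\<^sup>2" .
  qed (use e in simp)
  then show "\<exists>N. \<forall>m\<ge>N. \<forall>n. norm (sum F {m..<n}) < e" by blast
qed

lemma cinner_orthogonal_sums:
  fixes A :: "nat \<Rightarrow> hardy2"
  assumes orth: "\<And>i j. i \<noteq> j \<Longrightarrow> cinner (A i) (A j) = 0" and s: "(\<lambda>n. scaleC (c n) (A n)) sums s"
  shows "cinner s (A n) = c n * of_real ((norm (A n))\<^sup>2)"
proof -
  have "(\<lambda>k. cinner (scaleC (c k) (A k)) (A n)) sums cinner s (A n)"
    by (rule sums_cinner_left[OF s])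
  moreover have "(\<lambda>k. cinner (scaleC (c k) (A k)) (A n))
      = (\<lambda>k. if k = n then c k * of_real ((norm (A k))\<^sup>2) else 0)"
    by (auto simp: cinner_scaleC_left orth cinner_self_norm)
  ultimately show ?thesis
    using sums_single[of n "\<lambda>k. c k * of_real ((norm (A k))\<^sup>2)"] sums_unique2 by fastforce
qed

lemma norm_sq_orthogonal_sums:
  fixes A :: "nat \<Rightarrow> hardy2"
  assumes orth: "\<And>i j. i \<noteq> j \<Longrightarrow> cinner (A i) (A j) = 0" and s: "(\<lambda>n. scaleC (c n) (A n)) sums s"
  shows "(\<lambda>n. (cmod (c n))\<^sup>2 * (norm (A n))\<^sup>2) sums (norm s)\<^sup>2"
proof -
  have "(\<lambda>n. cinner (scaleC (c n) (A n)) s) sums cinner s s"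
    by (rule sums_cinner_left[OF s])
  moreover have "cinner (scaleC (c n) (A n)) s = of_real ((cmod (c n))\<^sup>2 * (norm (A n))\<^sup>2)" for n
  proof -
    have "cinner (A n) s = cnj (c n * of_real ((norm (A n))\<^sup>2))"
      using cinner_orthogonal_sums[where A = A and c = c, OF _ s, of n] orth
      by (subst cinner_commute) simp
    then show ?thesis
      by (simp add: cinner_scaleC_left complex_norm_square mult.assoc del: of_real_power)
  qed
  ultimately have "(\<lambda>n. of_real ((cmod (c n))\<^sup>2 * (norm (A n))\<^sup>2) :: complex) sums of_real ((norm s)\<^sup>2)"
    by (simp only: cinner_self_norm)
  then show ?thesis by (simp only: sums_of_real_iff)
qed

section \<open>Existence of orthonormal bases and Parseval's identity\<close>

lemma closure_subspace:
  assumes "hardy2.subspace S"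
  shows "hardy2.subspace (closure S)"
proof -
  have bl: "bounded_linear (scaleC c)" for c
    by (rule bounded_linear_intro[of _ "cmod c"])
      (simp_all add: hardy2.scale_right_distrib scaleR_eq_scaleC norm_scaleC mult.commute)
  have "x + y \<in> closure S" if xy: "x \<in> closure S" "y \<in> closure S" for x y
  proof -
    obtain f g where "\<And>n. f n \<in> S" "f \<longlonglongrightarrow> x" "\<And>n. g n \<in> S" "g \<longlonglongrightarrow> y"
      using xy unfolding closure_sequential by blast
    then show ?thesis
      unfolding closure_sequential
      by (intro exI[of _ "\<lambda>n. f n + g n"]) (auto intro!: tendsto_add hardy2.subspace_add[OF assms])
  qed
  moreover have "scaleC c x \<in> closure S" if x: "x \<in> closure S" for c x
  proof -
    obtain f where "\<And>n. f n \<in> S" "f \<longlonglongrightarrow> x"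
      using x unfolding closure_sequential by blast
    then show ?thesis
      unfolding closure_sequential
      by (intro exI[of _ "\<lambda>n. scaleC c (f n)"])
        (auto intro!: bounded_linear.tendsto[OF bl] hardy2.subspace_scale[OF assms])
  qed
  moreover have "0 \<in> closure S"
    using hardy2.subspace_0[OF assms] closure_subset by blast
  ultimately show ?thesis by (auto simp: hardy2.subspace_def)
qed

text \<open>\<open>hs_norm_on\<close> picks a basis by \<open>SOME\<close>, so a basis must be known
  to exist. Zorn gives a maximal orthonormal subset of \<open>Q\<close>; an element of
  \<open>Q\<close> outside its closed span, minus its projection and normalised, would enlarge
  it.\<close>

lemma orthonormal_basis_exists:
  assumes Q: "hardy2.subspace Q" "closed Q"
  shows "\<exists>E. orthonormal_basis Q E"
proof -
  define ons where "ons E \<longleftrightarrow> (\<forall>e\<in>E. \<forall>f\<in>E. cinner e f = (if e = f then 1 else 0))"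
    for E :: "hardy2 set"
  have "\<exists>M\<in>{E. E \<subseteq> Q \<and> ons E}. \<forall>X\<in>{E. E \<subseteq> Q \<and> ons E}. M \<subseteq> X \<longrightarrow> X = M"
  proof (rule Zorn_Lemma, intro ballI)
    fix C assume "C \<in> chains {E. E \<subseteq> Q \<and> ons E}"
    then have C: "\<And>E. E \<in> C \<Longrightarrow> E \<subseteq> Q \<and> ons E" "\<And>E F. E \<in> C \<Longrightarrow> F \<in> C \<Longrightarrow> E \<subseteq> F \<or> F \<subseteq> E"
      by (auto simp: chains_def chain_subset_def)
    have "ons (\<Union>C)"
      unfolding ons_def
    proof (intro ballI)
      fix e f assume "e \<in> \<Union>C" "f \<in> \<Union>C"
      then obtain E F where EF: "E \<in> C" "F \<in> C" "e \<in> E" "f \<in> F" by blast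
      then have "\<exists>G\<in>C. e \<in> G \<and> f \<in> G" using C(2)[of E F] by blast
      then show "cinner e f = (if e = f then 1 else 0)" using C(1) unfolding ons_def by blast
    qed
    then show "\<Union>C \<in> {E. E \<subseteq> Q \<and> ons E}" using C(1) by blast
  qed
  then obtain M where M: "M \<subseteq> Q" "ons M" and max: "\<And>X. X \<subseteq> Q \<Longrightarrow> ons X \<Longrightarrow> M \<subseteq> X \<Longrightarrow> X = M"
    by auto
  define R where "R = closure (hardy2.span M)"
  have R: "hardy2.subspace R" "closed R"
    by (simp_all add: R_def closure_subspace)
  have RQ: "R \<subseteq> Q"
    unfolding R_def using M(1) Q by (intro closure_minimal hardy2.span_minimal)
  have MR: "M \<subseteq> R"
    unfolding R_def using hardy2.span_superset closure_subset by blast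
  have "Q \<subseteq> R"
  proof
    fix f assume f: "f \<in> Q"
    define h where "h = f - proj_on R f"
    have hR: "cinner h r = 0" if "r \<in> R" for r
      using proj_on(2)[OF R that, of f] by (simp add: h_def cinner_diff_left)
    show "f \<in> R"
    proof (cases "h = 0")
      case True
      then show ?thesis using proj_on(1)[OF R, of f] by (simp add: h_def)
    next
      case False
      define e where "e = scaleC (of_real (inverse (norm h))) h"
      have "h \<in> Q"
        unfolding h_def using f proj_on(1)[OF R] RQ by (intro hardy2.subspace_diff[OF Q(1)]) auto
      then have eQ: "e \<in> Q" unfolding e_def by (intro hardy2.subspace_scale[OF Q(1)])
      have eR: "cinner e r = 0" if "r \<in> R" for r
        using hR[OF that] by (simp add: e_def cinner_scaleC_left)
      have "norm e = 1" using False by (simp add: e_def norm_scaleC norm_inverse)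
      then have ee: "cinner e e = 1" by (simp add: cinner_self_norm)
      have "ons (insert e M)"
        using M(2) ee eR MR unfolding ons_def
        by (auto simp: cinner_eq_0_commute)
      then have "insert e M = M"
        using eQ M(1) by (intro max) auto
      then have "e \<in> R" using MR by blast
      then show ?thesis using eR[of e] ee by simp
    qed
  qed
  then show ?thesis
    using RQ M(2) unfolding R_def orthonormal_basis_def ons_def by blast
qed

text \<open>Bessel bounds every finite partial sum from above. From below, \<open>f\<close> is close
  to a finite combination of basis vectors, and the projection to their span is at least as
  close.\<close>

lemma parseval:
  assumes E: "orthonormal_basis Q E" and f: "f \<in> Q"
  shows "((\<lambda>e. (cmod (cinner f e))\<^sup>2) has_sum (norm f)\<^sup>2) E"
proof -
  have ons: "\<And>e e'. e \<in> E \<Longrightarrow> e' \<in> E \<Longrightarrow> cinner e e' = (if e = e' then 1 else 0)"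
    and fcl: "f \<in> closure (hardy2.span E)"
    using E f by (auto simp: orthonormal_basis_def)
  have n1: "norm e = 1" if "e \<in> E" for e
  proof -
    have "of_real ((norm e)\<^sup>2) = (1 :: complex)"
      using ons[OF that that] by (simp add: cinner_self_norm)
    then have "(norm e)\<^sup>2 = 1" using of_real_eq_1_iff by blast
    then show ?thesis using power2_eq_iff_nonneg[of "norm e" 1] by simp
  qed
  have bessel: "(\<Sum>e\<in>F. (cmod (cinner f e))\<^sup>2) \<le> (norm f)\<^sup>2" if F: "finite F" "F \<subseteq> E" for F
  proof -
    have "(\<Sum>e\<in>F. (cmod (cinner f e))\<^sup>2 / (norm e)\<^sup>2) \<le> (norm f)\<^sup>2"
    proof (rule bessel_inequality[OF F(1)])
      show "e \<noteq> 0" if "e \<in> F" for e using n1[of e] F(2) that by auto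
      show "cinner e j = 0" if "e \<in> F" "j \<in> F" "e \<noteq> j" for e j
        using ons[of e j] F(2) that by auto
    qed
    moreover have "(\<Sum>e\<in>F. (cmod (cinner f e))\<^sup>2 / (norm e)\<^sup>2) = (\<Sum>e\<in>F. (cmod (cinner f e))\<^sup>2)"
      by (rule sum.cong) (use n1 F(2) in auto)
    ultimately show ?thesis by simp
  qed
  have approx: "\<exists>F. finite F \<and> F \<subseteq> E \<and> (norm f)\<^sup>2 - \<epsilon>\<^sup>2 < (\<Sum>e\<in>F. (cmod (cinner f e))\<^sup>2)"
    if \<epsilon>: "\<epsilon> > 0" for \<epsilon>
  proof -
    obtain g where g: "g \<in> hardy2.span E" "norm (f - g) < \<epsilon>"
      using fcl \<epsilon> unfolding closure_approachable by (auto simp: dist_norm norm_minus_commute)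
    then obtain F r where F: "finite F" "F \<subseteq> E" "g = (\<Sum>e\<in>F. scaleC (r e) e)"
      unfolding hardy2.span_explicit by blast
    have onsF: "cinner e e' = (if e = e' then 1 else 0)" if "e \<in> F" "e' \<in> F" for e e'
      using ons F(2) that by blast
    define p where "p = (\<Sum>e\<in>F. scaleC (cinner f e) e)"
    have orth: "cinner (f - p) e = 0" if "e \<in> F" for e
    proof -
      have "cinner p e = (\<Sum>x\<in>F. if x = e then cinner f e else 0)"
        unfolding p_def cinner_sum_left cinner_scaleC_left
        by (rule sum.cong) (simp_all add: onsF that)
      then show ?thesis using F(1) that by (simp add: cinner_diff_left)
    qed
    have comb: "cinner (f - p) (\<Sum>e\<in>F. scaleC (c e) e) = 0" for c
      by (simp add: cinner_sum_right cinner_scaleC_right orth)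
    \<comment> \<open>\<open>p\<close> is the projection of \<open>f\<close> to the span of
      \<open>F\<close>, and \<open>g\<close> lies in that span; so \<open>f - g\<close> splits
      orthogonally and its norm dominates that of \<open>f - p\<close>.\<close>
    have "cinner (f - p) (p - g) = 0"
      using comb[of "cinner f"] comb[of r] by (simp add: cinner_diff_right p_def F(3))
    then have "(norm (f - g))\<^sup>2 = (norm (f - p))\<^sup>2 + (norm (p - g))\<^sup>2"
      using norm_sq_add_orthogonal[of "f - p" "p - g"] by simp
    moreover have "(norm f)\<^sup>2 = (norm (f - p))\<^sup>2 + (norm p)\<^sup>2"
      using norm_sq_add_orthogonal[of "f - p" p] comb[of "cinner f"] by (simp add: p_def)
    moreover have "(norm p)\<^sup>2 = (\<Sum>e\<in>F. (norm (scaleC (cinner f e) e))\<^sup>2)"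
      unfolding p_def
      by (rule norm_sq_sum_orthogonal[OF F(1)])
        (simp add: cinner_scaleC_left cinner_scaleC_right onsF)
    moreover have "\<dots> = (\<Sum>e\<in>F. (cmod (cinner f e))\<^sup>2)"
      by (rule sum.cong) (use n1 F(2) in \<open>auto simp: norm_scaleC\<close>)
    moreover have "(norm (f - g))\<^sup>2 < \<epsilon>\<^sup>2"
      using g(2) by (intro power_strict_mono) auto
    ultimately show ?thesis
      using F(1,2) zero_le_power2[of "norm (p - g)"] by (intro exI[of _ F]) linarith
  qed
  show ?thesis
    unfolding has_sum_def
  proof (rule order_tendstoI)
    fix a assume a: "a < (norm f)\<^sup>2"
    then obtain F where F: "finite F" "F \<subseteq> E" "a < (\<Sum>e\<in>F. (cmod (cinner f e))\<^sup>2)"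
      using approx[of "sqrt ((norm f)\<^sup>2 - a)"] by auto
    have "a < (\<Sum>e\<in>Y. (cmod (cinner f e))\<^sup>2)" if "finite Y" "F \<subseteq> Y" for Y
      using F(3) sum_mono2[OF that, of "\<lambda>e. (cmod (cinner f e))\<^sup>2"] by simp
    then show "eventually (\<lambda>Y. a < (\<Sum>e\<in>Y. (cmod (cinner f e))\<^sup>2)) (finite_subsets_at_top E)"
      unfolding eventually_finite_subsets_at_top using F(1,2) by blast
  next
    fix a assume "a > (norm f)\<^sup>2"
    then show "eventually (\<lambda>Y. (\<Sum>e\<in>Y. (cmod (cinner f e))\<^sup>2) < a) (finite_subsets_at_top E)"
      unfolding eventually_finite_subsets_at_top using bessel by (intro exI[of _ "{}"]) force
  qed
qed

section \<open>Operators given by an orthogonal expansion\<close>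

text \<open>A singular value decomposition with unnormalised vectors: the n-th singular value is
  \<open>norm (A n) * norm (B n)\<close>. The assumption \<open>tendsto_zero\<close> makes the level
  sets finite and, through boundedness, the series of the adjoint convergent.\<close>

locale orthogonal_expansion =
  fixes Q :: "hardy2 set" and Y :: "hardy2 \<Rightarrow> hardy2" and A B :: "nat \<Rightarrow> hardy2"
  assumes subspace: "hardy2.subspace Q" and closed: "closed Q"
    and A_mem: "A n \<in> Q"
    and A_orthogonal: "m \<noteq> n \<Longrightarrow> cinner (A m) (A n) = 0"
    and B_orthogonal: "m \<noteq> n \<Longrightarrow> cinner (B m) (B n) = 0"
    and A_nonzero: "A n \<noteq> 0" and B_nonzero: "B n \<noteq> 0"
    and expansion: "f \<in> Q \<Longrightarrow> (\<lambda>n. scaleC (cinner f (A n)) (B n)) sums Y f"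
    and tendsto_zero: "(\<lambda>n. norm (A n) * norm (B n)) \<longlonglongrightarrow> 0"
begin

text \<open>The terms of the adjoint of \<open>Y\<close> applied to \<open>Y f\<close>: pairing
  \<open>Y f\<close> with \<open>B n\<close> produces the factor
  \<open>(norm (B n))^2\<close>.\<close>

definition adjoint_term :: "hardy2 \<Rightarrow> nat \<Rightarrow> hardy2" where
  "adjoint_term f n = scaleC (cinner f (A n) * of_real ((norm (B n))\<^sup>2)) (A n)"

lemma summable_adjoint_term: "summable (adjoint_term f)"
proof -
  obtain K where K: "\<And>n. norm (norm (A n) * norm (B n)) \<le> K"
    using convergent_imp_Bseq[OF convergentI[OF tendsto_zero]] unfolding Bseq_def by blast
  have "summable (\<lambda>n. (norm (adjoint_term f n))\<^sup>2)"
  proof (rule summable_comparison_test')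
    show "summable (\<lambda>n. K ^ 4 * ((cmod (cinner f (A n)))\<^sup>2 / (norm (A n))\<^sup>2))"
      by (intro summable_mult summable_bessel A_orthogonal A_nonzero)
    fix n
    \<comment> \<open>Arranged as a power of the bounded sequence times the quotient whose sum
      Bessel controls.\<close>
    have "(norm (adjoint_term f n))\<^sup>2
        = (norm (A n) * norm (B n)) ^ 4 * ((cmod (cinner f (A n)))\<^sup>2 / (norm (A n))\<^sup>2)"
      using A_nonzero[of n]
      by (simp add: adjoint_term_def norm_scaleC norm_mult norm_power power_mult_distrib field_simps
          eval_nat_numeral)
    also have "\<dots> \<le> K ^ 4 * ((cmod (cinner f (A n)))\<^sup>2 / (norm (A n))\<^sup>2)"
      using K[of n] by (intro mult_right_mono power_mono) auto
    finally show "norm ((norm (adjoint_term f n))\<^sup>2) \<le> K ^ 4 * ((cmod (cinner f (A n)))\<^sup>2 / (norm (A n))\<^sup>2)"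
      by simp
  qed
  then show ?thesis
    by (rule summable_orthogonal[rotated])
      (simp add: adjoint_term_def cinner_scaleC_left cinner_scaleC_right A_orthogonal)
qed

lemma adjoint_sums:
  assumes f: "f \<in> Q"
  shows "adjoint_term f sums adjoint_on Q Y (Y f)"
proof -
  define h where "h = suminf (adjoint_term f)"
  have h: "adjoint_term f sums h" using summable_adjoint_term by (simp add: h_def summable_sums)
  have "h \<in> Q"
  proof (rule closed_sequentially[OF closed])
    show "(\<lambda>n. \<Sum>i<n. adjoint_term f i) \<longlonglongrightarrow> h" using h by (simp add: sums_def)
    show "(\<Sum>i<n. adjoint_term f i) \<in> Q" for n
      unfolding adjoint_term_def by (intro hardy2.subspace_sum hardy2.subspace_scale subspace A_mem)
  qed
  moreover have "cinner (Y g) (Y f) = cinner g h" if g: "g \<in> Q" for g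
  proof -
    have "(\<lambda>n. cinner (scaleC (cinner g (A n)) (B n)) (Y f)) sums cinner (Y g) (Y f)"
      by (rule sums_cinner_left[OF expansion[OF g]])
    moreover have "cinner (scaleC (cinner g (A n)) (B n)) (Y f) = cinner g (adjoint_term f n)" for n
    proof -
      have "cinner (B n) (Y f) = cnj (cinner f (A n) * of_real ((norm (B n))\<^sup>2))"
        using cinner_orthogonal_sums[where A = B, OF _ expansion[OF f], of n] B_orthogonal
        by (subst cinner_commute) simp
      then show ?thesis by (simp add: adjoint_term_def cinner_scaleC_left cinner_scaleC_right mult_ac)
    qed
    ultimately show ?thesis
      using sums_cinner_right[OF h, of g] sums_unique2 by simp
  qed
  ultimately have "adjoint_on Q Y (Y f) = h"
    by (rule adjoint_on_eqI[OF subspace])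
  then show ?thesis using h by simp
qed

lemma finite_level_set:
  assumes "\<sigma> > 0"
  shows "finite {n. norm (A n) * norm (B n) = \<sigma>}"
proof -
  obtain N where "\<And>n. n \<ge> N \<Longrightarrow> norm (A n) * norm (B n) < \<sigma>"
    using order_tendstoD(2)[OF tendsto_zero assms] unfolding eventually_sequentially by blast
  then have "{n. norm (A n) * norm (B n) = \<sigma>} \<subseteq> {..<N}"
    by (metis (mono_tags, lifting) less_irrefl lessThan_iff linorder_not_less mem_Collect_eq subsetI)
  then show ?thesis by (rule finite_subset) simp
qed

text \<open>The adjoint of \<open>Y\<close> times \<open>Y\<close> is diagonal along the
  \<open>A n\<close> with eigenvalues \<open>(norm (A n) * norm (B n))^2\<close>. As
  \<open>\<sigma> > 0\<close>, an eigenvector is a multiple of its own image and hence lies in the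
  span of the \<open>A n\<close>, although these may be incomplete in \<open>Q\<close>.\<close>

lemma eigenspace:
  assumes "\<sigma> > 0"
  defines "L \<equiv> {n. norm (A n) * norm (B n) = \<sigma>}"
  shows "{f \<in> Q. adjoint_on Q Y (Y f) = scaleC (of_real (\<sigma>\<^sup>2)) f} = hardy2.span (A ` L)"
proof (intro equalityI subsetI)
  fix f assume "f \<in> {f \<in> Q. adjoint_on Q Y (Y f) = scaleC (of_real (\<sigma>\<^sup>2)) f}"
  then have f: "f \<in> Q" and s: "adjoint_term f sums scaleC (of_real (\<sigma>\<^sup>2)) f"
    using adjoint_sums[of f] by auto
  have "adjoint_term f n = 0" if "n \<notin> L" for n
  proof -
    have "cinner (scaleC (of_real (\<sigma>\<^sup>2)) f) (A n)
        = cinner f (A n) * of_real ((norm (B n))\<^sup>2) * of_real ((norm (A n))\<^sup>2)"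
      by (rule cinner_orthogonal_sums[OF A_orthogonal]) (use s in \<open>simp_all add: adjoint_term_def[abs_def]\<close>)
    then have "cinner f (A n) * of_real ((norm (A n) * norm (B n))\<^sup>2 - \<sigma>\<^sup>2) = 0"
      by (auto simp add: cinner_scaleC_left power_mult_distrib algebra_simps)
    moreover have "(norm (A n) * norm (B n))\<^sup>2 \<noteq> \<sigma>\<^sup>2"
      using that assms(1) by (simp add: L_def power2_eq_iff_nonneg)
    ultimately have "cinner f (A n) = 0"
      by (simp only: mult_eq_0_iff of_real_eq_0_iff right_minus_eq) simp
    then show ?thesis by (simp add: adjoint_term_def)
  qed
  then have "adjoint_term f sums (\<Sum>n\<in>L. adjoint_term f n)"
    by (intro sums_finite) (auto simp: L_def finite_level_set[OF assms(1)])
  then have e: "scaleC (of_real (\<sigma>\<^sup>2)) f = (\<Sum>n\<in>L. adjoint_term f n)"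
    using s sums_unique2 by blast
  have "(\<Sum>n\<in>L. adjoint_term f n) \<in> hardy2.span (A ` L)"
    unfolding adjoint_term_def by (intro hardy2.span_sum hardy2.span_scale hardy2.span_base imageI)
  then have "scaleC (inverse (of_real (\<sigma>\<^sup>2))) (scaleC (of_real (\<sigma>\<^sup>2)) f) \<in> hardy2.span (A ` L)"
    unfolding e by (rule hardy2.span_scale)
  then show "f \<in> hardy2.span (A ` L)" using assms(1) by simp
next
  fix f assume "f \<in> hardy2.span (A ` L)"
  then have "f \<in> Q \<and> adjoint_term f sums scaleC (of_real (\<sigma>\<^sup>2)) f"
  proof (induction rule: hardy2.span_induct_alt)
    case base
    then show ?case
      by (simp add: hardy2.subspace_0[OF subspace] adjoint_term_def[abs_def])
  next
    case (step c x y)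
    then obtain n where n: "n \<in> L" "x = A n" by blast
    have "adjoint_term (scaleC c x + y) = (\<lambda>k. (if k = n then adjoint_term (scaleC c x) k else 0) + adjoint_term y k)"
      using A_orthogonal[of n]
      by (auto simp: fun_eq_iff adjoint_term_def n(2) cinner_add_left cinner_scaleC_left ring_distribs
          hardy2.scale_left_distrib)
    moreover have "adjoint_term (scaleC c x) n = scaleC (of_real (\<sigma>\<^sup>2)) (scaleC c x)"
      using n by (auto simp: adjoint_term_def L_def cinner_scaleC_left cinner_self_norm power_mult_distrib mult_ac)
    ultimately have "adjoint_term (scaleC c x + y) sums
        (scaleC (of_real (\<sigma>\<^sup>2)) (scaleC c x) + scaleC (of_real (\<sigma>\<^sup>2)) y)"
      using sums_add[OF sums_single[of n "adjoint_term (scaleC c x)"]] step(2) by simp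
    moreover have "scaleC c x + y \<in> Q"
      using step n A_mem by (auto intro!: hardy2.subspace_add hardy2.subspace_scale subspace)
    ultimately show ?case by (simp add: hardy2.scale_right_distrib)
  qed
  then show "f \<in> {f \<in> Q. adjoint_on Q Y (Y f) = scaleC (of_real (\<sigma>\<^sup>2)) f}"
    using adjoint_sums[of f] sums_unique2 by blast
qed

lemma inj_A: "inj A"
proof (rule injI, rule ccontr)
  fix m n assume "A m = A n" "m \<noteq> n"
  then have "cinner (A n) (A n) = 0" using A_orthogonal[of m n] by simp
  then show False using A_nonzero[of n] by (simp add: cinner_self_norm)
qed

lemma independent_A: "\<not> hardy2.dependent (A ` L)"
proof
  assume "hardy2.dependent (A ` L)"
  then obtain n where n: "n \<in> L" "A n \<in> hardy2.span (A ` L - {A n})"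
    unfolding hardy2.dependent_def by blast
  have "cinner (A n) (A n) = 0"
    by (rule orthogonal_span[OF _ n(2)]) (auto intro!: A_orthogonal)
  then show False using A_nonzero[of n] by (simp add: cinner_self_norm)
qed

theorem singular_values:
  "enumerates_nonzero_singular_values Q Y (\<lambda>n. norm (A n) * norm (B n))"
  unfolding enumerates_nonzero_singular_values_def
proof (intro conjI allI impI)
  show "0 < norm (A n) * norm (B n)" for n
    using A_nonzero B_nonzero by simp
  fix \<sigma> :: real assume \<sigma>: "\<sigma> > 0"
  let ?L = "{n. norm (A n) * norm (B n) = \<sigma>}"
  show "finite ?L" using \<sigma> by (rule finite_level_set)
  then show "has_cdim {f \<in> Q. adjoint_on Q Y (Y f) = scaleC (of_real (\<sigma>\<^sup>2)) f} (card ?L)"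
    unfolding has_cdim_def eigenspace[OF \<sigma>]
    by (intro exI[of _ "A ` ?L"] conjI finite_imageI independent_A card_image refl)
      (auto intro: inj_on_subset[OF inj_A])
qed

text \<open>A double sum of nonnegative terms \<open>F (n, e)\<close>: summing over \<open>e\<close>
  first gives the squared singular value by Parseval for \<open>A n\<close>, summing over
  \<open>n\<close> first gives \<open>(norm (Y e))^2\<close> by orthogonality of the
  \<open>B n\<close>.\<close>

theorem hilbert_schmidt_has_sum:
  assumes E: "orthonormal_basis Q E" and s: "summable (\<lambda>n. (norm (A n) * norm (B n))\<^sup>2)"
  shows "((\<lambda>e. (norm (Y e))\<^sup>2) has_sum (\<Sum>n. (norm (A n) * norm (B n))\<^sup>2)) E"
proof -
  define F where "F = (\<lambda>(n, e). (cmod (cinner e (A n)))\<^sup>2 * (norm (B n))\<^sup>2)"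
  have EQ: "E \<subseteq> Q"
    using E hardy2.span_superset closure_subset unfolding orthonormal_basis_def by blast
  have 1: "((\<lambda>e. F (n, e)) has_sum (norm (A n) * norm (B n))\<^sup>2) E" for n
  proof -
    have "((\<lambda>e. (cmod (cinner (A n) e))\<^sup>2 * (norm (B n))\<^sup>2) has_sum (norm (A n))\<^sup>2 * (norm (B n))\<^sup>2) E"
      by (intro has_sum_cmult_left parseval[OF E A_mem])
    moreover have "cmod (cinner (A n) e) = cmod (cinner e (A n))" for e
      by (subst cinner_commute) simp
    ultimately show ?thesis by (simp add: F_def power_mult_distrib)
  qed
  have 2: "((\<lambda>n. F (n, e)) has_sum (norm (Y e))\<^sup>2) UNIV" if "e \<in> E" for e
    unfolding F_def prod.case
    by (rule sums_nonneg_imp_has_sum[OF norm_sq_orthogonal_sums[OF B_orthogonal expansion]])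
      (use that EQ in auto)
  have 3: "((\<lambda>n. (norm (A n) * norm (B n))\<^sup>2) has_sum (\<Sum>n. (norm (A n) * norm (B n))\<^sup>2)) UNIV"
    using s by (intro sums_nonneg_imp_has_sum summable_sums) auto
  have "F summable_on (UNIV \<times> E)"
    by (rule summable_on_SigmaI[OF 1 has_sum_imp_summable[OF 3]]) (auto simp: F_def)
  then have "(F has_sum (\<Sum>n. (norm (A n) * norm (B n))\<^sup>2)) (UNIV \<times> E)"
    by (rule has_sum_SigmaI[OF 1 3])
  then have "((\<lambda>(e, n). F (n, e)) has_sum (\<Sum>n. (norm (A n) * norm (B n))\<^sup>2)) (E \<times> UNIV)"
    by (subst has_sum_swap) (simp add: case_prod_unfold)
  then show ?thesis
    by (rule has_sum_SigmaD) (use 2 in simp)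
qed

theorem hilbert_schmidt:
  assumes "summable (\<lambda>n. (norm (A n) * norm (B n))\<^sup>2)"
  shows "hilbert_schmidt_on Q Y"
    and "(hs_norm_on Q Y)\<^sup>2 = (\<Sum>n. (norm (A n) * norm (B n))\<^sup>2)"
proof -
  show "hilbert_schmidt_on Q Y"
    unfolding hilbert_schmidt_on_def
    using has_sum_imp_summable[OF hilbert_schmidt_has_sum[OF _ assms]] by blast
  have "orthonormal_basis Q (SOME E. orthonormal_basis Q E)"
    using orthonormal_basis_exists[OF subspace closed] by (rule someI_ex)
  then have "(\<Sum>\<^sub>\<infinity>e\<in>(SOME E. orthonormal_basis Q E). (norm (Y e))\<^sup>2) = (\<Sum>n. (norm (A n) * norm (B n))\<^sup>2)"
    by (rule infsumI[OF hilbert_schmidt_has_sum[OF _ assms]])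
  then show "(hs_norm_on Q Y)\<^sup>2 = (\<Sum>n. (norm (A n) * norm (B n))\<^sup>2)"
    unfolding hs_norm_on_def by (simp add: suminf_nonneg[OF assms])
qed

end

section \<open>Finite differences\<close>

text \<open>An \<open>m\<close>-th finite difference kills powers below \<open>m\<close>. The shift
  \<open>a\<close> is free because absorption, k (m choose k) = m (m-1 choose k-1), lowers
  \<open>m\<close> and \<open>d\<close> together and replaces \<open>a\<close> by
  \<open>1 + a\<close>.\<close>

lemma alternating_binomial_sum_power:
  fixes a :: "'a :: comm_ring_1"
  assumes "d < m"
  shows "(\<Sum>k\<le>m. (-1) ^ k * of_nat (m choose k) * (of_nat k + a) ^ d) = 0"
  using assms
proof (induction d arbitrary: m a)
  case 0
  then show ?case using choose_alternating_sum[of m, where 'a = 'a] by simp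
next
  case (Suc d)
  obtain l where l: "m = Suc l" using Suc.prems by (cases m) auto
  have "(\<Sum>k\<le>m. (-1) ^ k * of_nat (m choose k) * (of_nat k + a) ^ Suc d)
      = (\<Sum>k\<le>m. (-1) ^ k * of_nat (k * (m choose k)) * (of_nat k + a) ^ d)
        + a * (\<Sum>k\<le>m. (-1) ^ k * of_nat (m choose k) * (of_nat k + a) ^ d)"
    by (simp add: sum_distrib_left flip: sum.distrib) (simp add: algebra_simps)
  also have "(\<Sum>k\<le>m. (-1) ^ k * of_nat (m choose k) * (of_nat k + a) ^ d) = 0"
    by (rule Suc.IH) (use Suc.prems in simp)
  also have "(\<Sum>k\<le>m. (-1) ^ k * of_nat (k * (m choose k)) * (of_nat k + a) ^ d)
      = (\<Sum>k\<le>l. (-1) ^ Suc k * of_nat (Suc l * (l choose k)) * (of_nat (Suc k) + a) ^ d)"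
    unfolding l sum.atMost_Suc_shift
    by (simp only: Suc_times_binomial mult_0 of_nat_0 mult_zero_right mult_zero_left add_0)
  also have "\<dots> = - of_nat (Suc l) * (\<Sum>k\<le>l. (-1) ^ k * of_nat (l choose k) * (of_nat k + (1 + a)) ^ d)"
    unfolding sum_distrib_left by (rule sum.cong) (simp_all add: algebra_simps)
  also have "(\<Sum>k\<le>l. (-1) ^ k * of_nat (l choose k) * (of_nat k + (1 + a)) ^ d) = 0"
    by (rule Suc.IH) (use Suc.prems l in simp)
  finally show ?case by simp
qed

lemma alternating_binomial_sum_poly:
  fixes p :: "'a :: comm_ring_1 poly"
  assumes "degree p < m"
  shows "(\<Sum>k\<le>m. (-1) ^ k * of_nat (m choose k) * poly p (of_nat k)) = 0"
proof -
  have "(\<Sum>k\<le>m. (-1) ^ k * of_nat (m choose k) * poly p (of_nat k))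
      = (\<Sum>i\<le>degree p. coeff p i * (\<Sum>k\<le>m. (-1) ^ k * of_nat (m choose k) * (of_nat k + 0) ^ i))"
    unfolding poly_altdef sum_distrib_left
    by (subst sum.swap) (simp add: algebra_simps)
  also have "\<dots> = 0"
    using assms by (intro sum.neutral ballI) (simp only: alternating_binomial_sum_power mult_zero_right atMost_iff)
  finally show ?thesis .
qed

section \<open>The orthogonal polynomials on the circle for the weight |1 - x|^(2N)\<close>

lemma fact_add: "fact (m + N) = fact m * (\<Prod>r=1..N. of_nat m + of_nat r :: 'a :: field_char_0)"
  by (induction N) (simp_all add: algebra_simps)

text \<open>The coefficient of x^j in the reversal of the monic orthogonal polynomial of degree
  \<open>n\<close>; hence the value 1 at \<open>j = 0\<close>.\<close>

definition ortho_coeff :: "nat \<Rightarrow> nat \<Rightarrow> nat \<Rightarrow> real" where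
  "ortho_coeff N n j
    = real ((N + j - 1) choose j) * real ((N + n - j) choose N) / real ((N + n) choose N)"

text \<open>The Fourier coefficient of |1 - x|^(2N) at \<open>i - j\<close>, so the matrix is
  Toeplitz. The guard catches truncated subtraction; on the other side, \<open>i > N + j\<close>,
  the binomial vanishes by itself.\<close>

definition diag_gram :: "nat \<Rightarrow> nat \<Rightarrow> nat \<Rightarrow> real" where
  "diag_gram N i j = (if j \<le> N + i then (-1) ^ (i + j) * real ((2 * N) choose (N + i - j)) else 0)"

text \<open>Interpolates the coefficients up to a constant factor; its zeros are -1, ..., -(N-1) and
  n+1, ..., n+N.\<close>

definition ortho_poly :: "nat \<Rightarrow> nat \<Rightarrow> real \<Rightarrow> real" where
  "ortho_poly N n x = (\<Prod>r=1..N-1. x + real r) * (\<Prod>r=1..N. real n - x + real r)"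

lemma ortho_poly_eq_0:
  assumes "N \<ge> 1" "- real N < real_of_int x" "x < 0 \<or> (int n < x \<and> x \<le> int (N + n))"
  shows "ortho_poly N n (of_int x) = 0"
proof (cases "x < 0")
  case True
  then have "nat (- x) \<in> {1..N-1}" "of_int x + real (nat (- x)) = 0"
    using assms by auto
  then have "(\<Prod>r=1..N-1. of_int x + real r) = 0"
    using prod_zero_iff[of "{1..N-1}"] by blast
  then show ?thesis by (simp add: ortho_poly_def)
next
  case False
  then have "nat (x - int n) \<in> {1..N}" "real n - of_int x + real (nat (x - int n)) = 0"
    using assms by auto
  then have "(\<Prod>r=1..N. real n - of_int x + real r) = 0"
    using prod_zero_iff[of "{1..N}"] by blast
  then show ?thesis by (simp add: ortho_poly_def)
qed

lemma ortho_poly_eq_coeff: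
  assumes "N \<ge> 1" "j \<le> n"
  shows "ortho_poly N n (real j)
    = fact (N - 1) * fact N * (real ((N + j - 1) choose j) * real ((N + n - j) choose N))"
proof -
  have 0: "N + j - 1 = j + (N - 1)" "N + n - j = n - j + N" using assms by auto
  have 1: "(\<Prod>r=1..N-1. real j + real r) = fact (N + j - 1) / fact j"
    unfolding 0 using fact_add[of j "N - 1", where 'a = real] by simp
  have 2: "(\<Prod>r=1..N. real n - real j + real r) = fact (N + n - j) / fact (n - j)"
    unfolding 0 using fact_add[of "n - j" N, where 'a = real] by (simp add: of_nat_diff[OF assms(2)])
  have 3: "real ((N + j - 1) choose j) = fact (N + j - 1) / (fact j * fact (N - 1))"
    using binomial_fact[of j "N + j - 1", where 'a = real] assms by (simp add: add_diff_cancel_right)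
  have 4: "real ((N + n - j) choose N) = fact (N + n - j) / (fact N * fact (n - j))"
    using binomial_fact[of N "N + n - j", where 'a = real] assms by (simp add: add_diff_cancel_right)
  show ?thesis unfolding ortho_poly_def 1 2 3 4 by simp
qed

text \<open>For \<open>i = 0\<close> this is the one node outside \<open>0, ..., n\<close> that is
  not a zero; its value is the source of \<open>1 / t_coeff n N\<close>.\<close>

lemma ortho_poly_neg:
  assumes "N \<ge> 1"
  shows "ortho_poly N n (- real N) = (-1) ^ (N - 1) * fact (N - 1) * (fact (n + 2 * N) / fact (n + N))"
proof -
  have "(\<Prod>r=1..N-1. - real N + real r) = (\<Prod>r=1..N-1. - 1 * real (N - r))"
    by (rule prod.cong) (use assms in auto)
  also have "\<dots> = (-1) ^ (N - 1) * (\<Prod>r=1..N-1. real (N - r))"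
    by (subst prod.distrib) simp
  also have "(\<Prod>r=1..N-1. real (N - r)) = (\<Prod>r=1..N-1. real r)"
    by (rule prod.reindex_bij_witness[of _ "\<lambda>r. N - r" "\<lambda>r. N - r"]) auto
  also have "\<dots> = fact (N - 1)" by (simp add: fact_prod)
  finally have 1: "(\<Prod>r=1..N-1. - real N + real r) = (-1) ^ (N - 1) * fact (N - 1)" .
  have "(\<Prod>r=1..N. real n - - real N + real r) = fact (n + N + N) / fact (n + N)"
    using fact_add[of "n + N" N, where 'a = real] by simp
  then show ?thesis unfolding ortho_poly_def 1 by (simp add: mult_2 add.assoc)
qed

text \<open>The coefficients are the values at \<open>0, \<dots>, n\<close> of a polynomial of degree \<open>2 N - 1\<close> which
  vanishes at the other integers that occur, so the sum is a \<open>2 N\<close>-th difference of that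
  polynomial, except that for \<open>i = 0\<close> the node \<open>- N\<close> is missing.\<close>

lemma ortho_coeff_diag_gram:
  assumes N: "N \<ge> 1" and i: "i \<le> n"
  shows "(\<Sum>j\<le>n. ortho_coeff N n j * diag_gram N i j) = (if i = 0 then 1 / t_coeff n N else 0)"
proof -
  define q where "q = ortho_poly N n"
  define f where "f k = (-1) ^ k * real ((2 * N) choose k) * q (real (N + i) - real k)" for k
  \<comment> \<open>\<open>ortho_poly\<close> after the substitution x to N + i - x, which moves the
    nodes i - N, ..., i + N to 0, ..., 2N.\<close>
  define p where "p = (\<Prod>r=1..N-1. [:real (N + i) + real r, -1:]) * (\<Prod>r=1..N. [:real n - real (N + i) + real r, 1:])"
  have "degree p < 2 * N"
  proof -
    have "degree (\<Prod>r=1..N-1. [:real (N + i) + real r, -1:]) \<le> N - 1"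
      using degree_prod_sum_le[of "{1..N-1}" "\<lambda>r. [:real (N + i) + real r, -1:]"] by (simp add: o_def)
    moreover have "degree (\<Prod>r=1..N. [:real n - real (N + i) + real r, 1:]) \<le> N"
      using degree_prod_sum_le[of "{1..N}" "\<lambda>r. [:real n - real (N + i) + real r, 1:]"] by (simp add: o_def)
    moreover have "degree p \<le> degree (\<Prod>r=1..N-1. [:real (N + i) + real r, -1:])
        + degree (\<Prod>r=1..N. [:real n - real (N + i) + real r, 1:])"
      unfolding p_def by (rule degree_mult_le)
    ultimately show ?thesis using N by linarith
  qed
  moreover have "poly p x = q (real (N + i) - x)" for x
    unfolding p_def q_def ortho_poly_def poly_mult poly_prod by (simp add: algebra_simps)
  ultimately have sum0: "(\<Sum>k\<le>2 * N. f k) = 0"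
    using alternating_binomial_sum_poly[of p "2 * N"] by (simp add: f_def)
  \<comment> \<open>The indices whose node \<open>N + i - k\<close> lies in
    \<open>0, ..., n\<close>. For \<open>i > N\<close> some of them may exceed \<open>2 * N\<close>;
    there the binomial makes \<open>f\<close> vanish.\<close>
  define K where "K = {k. k \<le> N + i \<and> N + i - k \<le> n}"
  have finK: "finite K" by (rule finite_subset[of _ "{..N + i}"]) (auto simp: K_def)
  have qz: "q (real (N + i) - real k) = 0" if "k \<le> 2 * N" "k \<notin> K" "i \<noteq> 0 \<or> k \<noteq> 2 * N" for k
  proof -
    have "q (of_int (int (N + i) - int k)) = 0"
      unfolding q_def by (rule ortho_poly_eq_0) (use N i that in \<open>auto simp: K_def\<close>)
    then show ?thesis by simp
  qed
  define e where "e = (if i = 0 then f (2 * N) else 0)"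
  have "(\<Sum>k\<le>2 * N. f k) = (\<Sum>k\<in>K. f k) + e"
  proof (cases "i = 0")
    case True
    then have "2 * N \<notin> K" using N by (auto simp: K_def)
    moreover have "(\<Sum>k\<in>insert (2 * N) K. f k) = (\<Sum>k\<le>2 * N. f k)"
      by (rule sum.mono_neutral_cong) (use finK qz in \<open>auto simp: f_def binomial_eq_0\<close>)
    ultimately show ?thesis using True finK by (simp add: e_def)
  next
    case False
    have "(\<Sum>k\<in>K. f k) = (\<Sum>k\<le>2 * N. f k)"
      by (rule sum.mono_neutral_cong) (use finK qz False in \<open>auto simp: f_def binomial_eq_0\<close>)
    then show ?thesis using False by (simp add: e_def)
  qed
  then have sumK: "(\<Sum>k\<in>K. f k) = - e" using sum0 by simp
  have "(\<Sum>k\<in>K. f k) = (\<Sum>j\<in>{j. j \<le> n \<and> j \<le> N + i}. f (N + i - j))"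
    by (rule sum.reindex_bij_witness[of _ "\<lambda>j. N + i - j" "\<lambda>k. N + i - k"]) (auto simp: K_def)
  also have "\<dots> = (\<Sum>j\<in>{j. j \<le> n \<and> j \<le> N + i}. (-1) ^ N * (q (real j) * diag_gram N i j))"
  proof (rule sum.cong)
    fix j assume "j \<in> {j. j \<le> n \<and> j \<le> N + i}"
    then have j: "j \<le> n" "j \<le> N + i" by auto
    have "(-1 :: real) ^ (N + i - j) = (-1) ^ N * (-1) ^ (i + j)"
      using j by (simp flip: power_add add: minus_one_power_iff)
    moreover have "real (N + i) - real (N + i - j) = real j" using j by simp
    ultimately show "f (N + i - j) = (-1) ^ N * (q (real j) * diag_gram N i j)"
      using j by (simp add: f_def diag_gram_def)
  qed simp
  also have "\<dots> = (\<Sum>j\<le>n. (-1) ^ N * (q (real j) * diag_gram N i j))"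
    by (rule sum.mono_neutral_left) (auto simp: diag_gram_def)
  also have "\<dots> = (\<Sum>j\<le>n. (-1) ^ N * (fact (N - 1) * fact N * real ((N + n) choose N))
      * (ortho_coeff N n j * diag_gram N i j))"
    by (rule sum.cong) (use N in \<open>auto simp: q_def ortho_poly_eq_coeff ortho_coeff_def\<close>)
  finally have main: "(-1) ^ N * (fact (N - 1) * fact N * real ((N + n) choose N))
      * (\<Sum>j\<le>n. ortho_coeff N n j * diag_gram N i j) = - e"
    using sumK by (simp add: sum_distrib_left)
  show ?thesis
  proof (cases "i = 0")
    case True
    have "f (2 * N) = - ((-1) ^ N * fact (N - 1) * (fact (n + 2 * N) / fact (n + N)))"
      using ortho_poly_neg[OF N, of n] True N by (cases N) (simp_all add: f_def q_def)
    then have "(-1) ^ N * (fact (N - 1) * (fact N * real ((N + n) choose N)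
        * (\<Sum>j\<le>n. ortho_coeff N n j * diag_gram N i j)))
      = (-1) ^ N * (fact (N - 1) * (fact (n + 2 * N) / fact (n + N)))"
      using main True by (simp add: e_def mult_ac)
    then have "fact N * real ((N + n) choose N) * (\<Sum>j\<le>n. ortho_coeff N n j * diag_gram N i j)
      = fact (n + 2 * N) / fact (n + N)"
      by (simp only: mult_cancel_left) simp
    moreover have "fact N * real ((N + n) choose N) = fact (n + N) / fact n"
      using binomial_fact[of N "N + n", where 'a = real] by (simp add: add.commute)
    ultimately show ?thesis
      using True by (simp add: t_coeff_def field_simps power2_eq_square)
  next
    case False
    then show ?thesis using main by (simp add: e_def)
  qed
qed

lemma ortho_coeff_0: "ortho_coeff N n 0 = 1"
  by (simp add: ortho_coeff_def)

lemma ortho_coeff_last: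
  assumes "N \<ge> 1"
  shows "ortho_coeff N n n = real N / real (n + N)"
proof -
  have 1: "real ((N + n - 1) choose n) = fact (N + n - 1) / (fact n * fact (N - 1))"
    using binomial_fact[of n "N + n - 1", where 'a = real] assms by (simp add: add_diff_cancel_right)
  have 2: "real ((N + n) choose N) = (real (N + n) * fact (N + n - 1)) / ((real N * fact (N - 1)) * fact n)"
    using binomial_fact[of N "N + n", where 'a = real] assms by (simp add: fact_reduce)
  have "ortho_coeff N n n = real ((N + n - 1) choose n) / real ((N + n) choose N)"
    by (simp add: ortho_coeff_def)
  then show ?thesis unfolding 1 2 using assms by (simp add: add.commute)
qed

section \<open>Estimates for the singular values\<close>

lemma t_coeff_eq_prod: "t_coeff n N = (\<Prod>r=1..N. real (n + r) / real (n + N + r))"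
proof -
  have 1: "(\<Prod>r=1..N. real (n + r)) = fact (n + N) / fact n"
    using fact_add[of n N, where 'a = real] by simp
  have 2: "(\<Prod>r=1..N. real (n + N + r)) = fact (n + 2 * N) / fact (n + N)"
    using fact_add[of "n + N" N, where 'a = real] by (simp add: mult_2 add.assoc)
  show ?thesis unfolding t_coeff_def prod_dividef 1 2 by (simp add: power2_eq_square)
qed

lemma t_coeff_pos: "t_coeff n N > 0"
  by (simp add: t_coeff_def)

text \<open>The factors of the product increase with \<open>r\<close>, so the last one bounds them
  all.\<close>

lemma t_coeff_le_power: "t_coeff n N \<le> (real (n + N) / real (n + 2 * N)) ^ N"
proof -
  have "t_coeff n N \<le> (\<Prod>r=1..N. real (n + N) / real (n + 2 * N))"
    unfolding t_coeff_eq_prod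
  proof (rule prod_mono)
    fix r assume r: "r \<in> {1..N}"
    then have "real (n + r) * real (n + 2 * N) \<le> real (n + N) * real (n + N + r)"
    proof -
      obtain d where "N = r + d" using r le_Suc_ex by auto
      then show ?thesis by (simp add: algebra_simps)
    qed
    then show "0 \<le> real (n + r) / real (n + N + r) \<and>
        real (n + r) / real (n + N + r) \<le> real (n + N) / real (n + 2 * N)"
      using r by (auto simp: divide_simps)
  qed
  then show ?thesis by simp
qed

lemma t_coeff_le_power_ratio:
  assumes "N \<ge> 1" "n \<le> K * N"
  shows "t_coeff n N \<le> (real (K + 1) / real (K + 2)) ^ N"
proof -
  have "real n \<le> real K * real N" using assms(2) by (metis of_nat_le_iff of_nat_mult)
  then have "real (n + N) / real (n + 2 * N) \<le> real (K + 1) / real (K + 2)"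
    using assms(1) by (simp add: divide_simps algebra_simps)
  then have "(real (n + N) / real (n + 2 * N)) ^ N \<le> (real (K + 1) / real (K + 2)) ^ N"
    by (intro power_mono) auto
  then show ?thesis using t_coeff_le_power[of n N] by linarith
qed

lemma t_coeff_less_1:
  assumes "N \<ge> 1"
  shows "t_coeff n N < 1"
proof -
  have "(real (n + N) / real (n + 2 * N)) ^ N < 1 ^ N"
    using assms by (intro power_strict_mono) (auto simp: divide_simps)
  then show ?thesis using t_coeff_le_power[of n N] by simp
qed

text \<open>With \<open>1 / t_coeff n N\<close> as the squared norm of the orthogonal polynomial,
  this is Szego's norm recursion; \<open>N / (Suc n + N)\<close> is the modulus of the Verblunsky
  coefficient, the last coefficient in \<open>ortho_coeff_last\<close>.\<close>

lemma t_coeff_ratio: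
  "t_coeff n N / t_coeff (Suc n) N = 1 - (real N / real (Suc n + N))\<^sup>2"
proof -
  have e: "t_coeff (Suc n) N
      = t_coeff n N * ((real (Suc n + N))\<^sup>2 / (real (Suc n) * real (Suc n + 2 * N)))"
    unfolding t_coeff_def add_Suc fact_Suc power_mult_distrib times_divide_times_eq
    by (simp only: mult_ac of_nat_id)
  have "t_coeff n N / t_coeff (Suc n) N = real (Suc n) * real (Suc n + 2 * N) / (real (Suc n + N))\<^sup>2"
    unfolding e using t_coeff_pos[of n N] by simp
  also have "real (Suc n) * real (Suc n + 2 * N) = (real (Suc n + N))\<^sup>2 - (real N)\<^sup>2"
    by (simp add: power2_eq_square algebra_simps)
  finally show ?thesis by (simp add: diff_divide_distrib power_divide)
qed

section \<open>Size and square sums of the singular values\<close>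

lemma \<beta>_eq:
  assumes "N \<ge> 1"
  shows "\<beta> n N = real N / real (n + N) * (1 - t_coeff n N)"
proof (cases "n = 0")
  case True
  have "t_coeff 0 N = 1 / real ((2 * N) choose N)"
    using binomial_fact[of N "2 * N", where 'a = real]
    by (simp add: t_coeff_def power2_eq_square)
  then show ?thesis using True assms by (simp add: \<beta>_def)
qed (simp add: \<beta>_def)

lemma \<beta>_pos: "N \<ge> 1 \<Longrightarrow> \<beta> n N > 0"
  using t_coeff_less_1[of N n] by (simp add: \<beta>_eq)

lemma \<beta>_le: "N \<ge> 1 \<Longrightarrow> \<beta> n N \<le> real N / real (n + N)"
  using mult_left_mono[of "1 - t_coeff n N" 1 "real N / real (n + N)"] t_coeff_pos[of n N]
  by (simp only: \<beta>_eq) simp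

lemma \<beta>_tendsto_0:
  assumes "N \<ge> 1"
  shows "(\<lambda>n. \<beta> n N) \<longlonglongrightarrow> 0"
proof (rule tendsto_sandwich)
  show "\<forall>\<^sub>F n in sequentially. 0 \<le> \<beta> n N"
    using \<beta>_pos[OF assms] by (simp add: less_imp_le)
  show "\<forall>\<^sub>F n in sequentially. \<beta> n N \<le> real N / real (n + N)"
    using \<beta>_le[OF assms] by simp
  show "(\<lambda>n. real N / real (n + N)) \<longlonglongrightarrow> 0"
    by (rule LIMSEQ_ignore_initial_segment[OF lim_const_over_n])
qed simp

lemma sum_\<beta>_sq_le:
  assumes "N \<ge> 1"
  shows "(\<Sum>n<m. (\<beta> (Suc n) N)\<^sup>2) \<le> real N"
proof -
  have "(\<Sum>n<m. (\<beta> (Suc n) N)\<^sup>2) \<le> (\<Sum>n<m. (real N)\<^sup>2 * (1 / real (n + N) - 1 / real (Suc n + N)))"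
  proof (rule sum_mono)
    fix n
    have "(\<beta> (Suc n) N)\<^sup>2 \<le> (real N / real (Suc n + N))\<^sup>2"
      using \<beta>_le[OF assms, of "Suc n"] \<beta>_pos[OF assms, of "Suc n"] by (intro power_mono) auto
    also have "\<dots> \<le> (real N)\<^sup>2 * (1 / real (n + N) - 1 / real (Suc n + N))"
      using assms by (simp add: power2_eq_square divide_simps)
    finally show "(\<beta> (Suc n) N)\<^sup>2 \<le> (real N)\<^sup>2 * (1 / real (n + N) - 1 / real (Suc n + N))" .
  qed
  also have "\<dots> = (real N)\<^sup>2 * (1 / real N - 1 / real (m + N))"
    using sum_lessThan_telescope'[of "\<lambda>n. 1 / real (n + N)" m] by (simp flip: sum_distrib_left)
  also have "\<dots> \<le> real N"
    using assms by (simp add: power2_eq_square divide_simps)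
  finally show ?thesis .
qed

lemma summable_\<beta>_sq_Suc:
  assumes "N \<ge> 1"
  shows "summable (\<lambda>n. (\<beta> (Suc n) N)\<^sup>2)"
  by (rule summableI_nonneg_bounded[of _ "real N"]) (use sum_\<beta>_sq_le[OF assms] in auto)

lemma summable_\<beta>_sq: "N \<ge> 1 \<Longrightarrow> summable (\<lambda>n. (\<beta> n N)\<^sup>2)"
  using summable_\<beta>_sq_Suc[of N] summable_Suc_iff[of "\<lambda>n. (\<beta> n N)\<^sup>2"] by blast

text \<open>The term at 0 is split off: telescoping yields \<open>N\<close> for the others, and
  \<open>\<beta> 0 N < 1\<close> makes the bound strict.\<close>

lemma suminf_\<beta>_sq_less:
  assumes "N \<ge> 1"
  shows "(\<Sum>n. (\<beta> n N)\<^sup>2) < real N + 1"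
proof -
  have "(\<Sum>n. (\<beta> (Suc n) N)\<^sup>2) \<le> real N"
    by (rule suminf_le_const[OF summable_\<beta>_sq_Suc[OF assms] sum_\<beta>_sq_le[OF assms]])
  moreover have "(\<beta> 0 N)\<^sup>2 < 1"
  proof -
    have "\<beta> 0 N < 1" using t_coeff_pos[of 0 N] assms by (simp add: \<beta>_eq)
    then show ?thesis using \<beta>_pos[OF assms, of 0] by (simp add: power_less_one_iff)
  qed
  moreover have "(\<Sum>n. (\<beta> n N)\<^sup>2) = (\<beta> 0 N)\<^sup>2 + (\<Sum>n. (\<beta> (Suc n) N)\<^sup>2)"
    using suminf_split_head[OF summable_\<beta>_sq[OF assms]] by simp
  ultimately show ?thesis by simp
qed

lemma \<beta>_sq_ge:
  assumes "N \<ge> 1" "n \<le> K * N"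
  shows "(\<beta> n N)\<^sup>2 \<ge> (1 - (real (K + 1) / real (K + 2)) ^ N)\<^sup>2 * (real N / real (n + N))\<^sup>2"
proof -
  have "(real (K + 1) / real (K + 2)) ^ N \<le> 1" by (intro power_le_one) auto
  then have "real N / real (n + N) * (1 - (real (K + 1) / real (K + 2)) ^ N) \<le> \<beta> n N"
    unfolding \<beta>_eq[OF assms(1)]
    using t_coeff_le_power_ratio[OF assms] by (intro mult_left_mono) auto
  then have "(real N / real (n + N) * (1 - (real (K + 1) / real (K + 2)) ^ N))\<^sup>2 \<le> (\<beta> n N)\<^sup>2"
    using \<open>(real (K + 1) / real (K + 2)) ^ N \<le> 1\<close> by (intro power_mono) auto
  then show ?thesis by (simp only: power_mult_distrib mult.commute)
qed

text \<open>Cutting at \<open>K * N\<close> gives a geometric bound on \<open>t_coeff n N\<close>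
  uniform in \<open>n\<close>. \<open>K = 1\<close> produces the explicit bound with 2/3, large
  \<open>K\<close> the limit.\<close>

lemma suminf_\<beta>_sq_ge:
  assumes "N \<ge> 1"
  shows "(\<Sum>n. (\<beta> n N)\<^sup>2) \<ge> (1 - (real (K + 1) / real (K + 2)) ^ N)\<^sup>2
    * (\<Sum>n=1..K * N. (real N / real (n + N))\<^sup>2)"
proof -
  have "(1 - (real (K + 1) / real (K + 2)) ^ N)\<^sup>2 * (\<Sum>n=1..K * N. (real N / real (n + N))\<^sup>2)
      \<le> (\<Sum>n=1..K * N. (\<beta> n N)\<^sup>2)"
    unfolding sum_distrib_left by (rule sum_mono) (rule \<beta>_sq_ge[OF assms], simp)
  also have "\<dots> \<le> (\<Sum>n. (\<beta> n N)\<^sup>2)"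
    by (rule sum_le_suminf[OF summable_\<beta>_sq[OF assms]]) auto
  finally show ?thesis .
qed

lemma suminf_\<beta>_sq_ge_quarter:
  assumes "N \<ge> 1"
  shows "(\<Sum>n. (\<beta> n N)\<^sup>2) \<ge> real N / 4 * (1 - (2 / 3) ^ N)\<^sup>2"
proof -
  \<comment> \<open>For \<open>n <= N\<close> the ratio is at least 1/2, and there are
    \<open>N\<close> such terms.\<close>
  have "(\<Sum>n=1..1 * N. (1 / 2)\<^sup>2) \<le> (\<Sum>n=1..1 * N. (real N / real (n + N))\<^sup>2)"
    using assms by (intro sum_mono power_mono) (auto simp: divide_simps)
  then have "real N / 4 \<le> (\<Sum>n=1..1 * N. (real N / real (n + N))\<^sup>2)"
    by (simp add: power2_eq_square)
  then have "(1 - (2 / 3) ^ N)\<^sup>2 * (real N / 4)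
      \<le> (1 - (2 / 3) ^ N)\<^sup>2 * (\<Sum>n=1..1 * N. (real N / real (n + N))\<^sup>2)"
    by (rule mult_left_mono) simp
  also have "\<dots> \<le> (\<Sum>n. (\<beta> n N)\<^sup>2)"
    using suminf_\<beta>_sq_ge[OF assms, of 1] by simp
  finally show ?thesis by (simp add: mult.commute)
qed

lemma sum_inverse_sq_ge:
  "(\<Sum>n=1..m. (real N / real (n + N))\<^sup>2) \<ge> (real N)\<^sup>2 * (1 / real (N + 1) - 1 / real (m + N + 1))"
proof (induction m)
  case (Suc m)
  have "(real N)\<^sup>2 * (1 / real (m + N + 1) - 1 / real (Suc m + N + 1)) \<le> (real N / real (Suc m + N))\<^sup>2"
    by (auto simp: power_divide power2_eq_square divide_simps intro!: mult_left_mono)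
      (simp_all add: algebra_simps)
  then show ?case using Suc by (simp add: algebra_simps)
qed simp

text \<open>From below, cutting at \<open>K * N\<close> keeps the share
  \<open>1 - 1 / (K + 1)\<close> in the limit, while the geometric factor tends to 1 for fixed
  \<open>K\<close>. From above, the bound \<open>N + 1\<close> suffices.\<close>

lemma suminf_\<beta>_sq_over_tendsto: "(\<lambda>N. (\<Sum>n. (\<beta> n N)\<^sup>2) / real N) \<longlonglongrightarrow> 1"
proof (rule order_tendstoI)
  fix a :: real assume a: "a < 1"
  \<comment> \<open>The discarded tail costs \<open>1 / (K + 1)\<close>, which has to stay below the
    gap \<open>1 - a\<close>.\<close>
  obtain K where K: "1 / real (Suc K) < 1 - a"
    using reals_Archimedean[of "1 - a"] a by (auto simp: inverse_eq_divide)
  define b where "b N = (1 - (real (K + 1) / real (K + 2)) ^ N)\<^sup>2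
    * (real N * (1 / real (N + 1) - 1 / real (K * N + N + 1)))" for N
  have L1: "(\<lambda>N. (real (K + 1) / real (K + 2)) ^ N) \<longlonglongrightarrow> 0"
    by (rule LIMSEQ_power_zero) simp
  have L2: "(\<lambda>N. real N * (1 / real (N + 1) - 1 / real (K * N + N + 1))) \<longlonglongrightarrow> 1 - 1 / real (Suc K)"
  proof -
    have lim: "(\<lambda>N. inverse (1 + inverse (real N)) - inverse (real (Suc K) + inverse (real N)))
        \<longlonglongrightarrow> inverse (1 + 0) - inverse (real (Suc K) + 0)"
      by (intro tendsto_intros lim_inverse_n) auto
    have "eventually (\<lambda>N. inverse (1 + inverse (real N)) - inverse (real (Suc K) + inverse (real N))
        = real N * (1 / real (N + 1) - 1 / real (K * N + N + 1))) sequentially"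
      using eventually_gt_at_top[of 0]
    proof eventually_elim
      case (elim N)
      have 1: "inverse (1 + inverse (real N)) = real N / real (N + 1)"
        using elim by (simp add: field_simps)
      have 2: "inverse (real (Suc K) + inverse (real N)) = real N / real (K * N + N + 1)"
        using elim by (simp add: field_simps)
      show ?case unfolding 1 2 by (simp add: right_diff_distrib)
    qed
    from Lim_transform_eventually[OF lim this] show ?thesis by (simp add: inverse_eq_divide)
  qed
  have "b \<longlonglongrightarrow> (1 - 0)\<^sup>2 * (1 - 1 / real (Suc K))"
    unfolding b_def by (intro tendsto_mult tendsto_power tendsto_diff tendsto_const L1 L2)
  then have "eventually (\<lambda>N. a < b N) sequentially"
    by (rule order_tendstoD) (use K in simp)
  then show "eventually (\<lambda>N. a < (\<Sum>n. (\<beta> n N)\<^sup>2) / real N) sequentially"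
    using eventually_gt_at_top[of 0]
  proof eventually_elim
    case (elim N)
    have "b N * real N = (1 - (real (K + 1) / real (K + 2)) ^ N)\<^sup>2
        * ((real N)\<^sup>2 * (1 / real (N + 1) - 1 / real (K * N + N + 1)))"
      by (simp add: b_def power2_eq_square mult_ac)
    also have "\<dots> \<le> (1 - (real (K + 1) / real (K + 2)) ^ N)\<^sup>2 * (\<Sum>n=1..K * N. (real N / real (n + N))\<^sup>2)"
      by (intro mult_left_mono sum_inverse_sq_ge) simp
    also have "\<dots> \<le> (\<Sum>n. (\<beta> n N)\<^sup>2)"
      using elim by (intro suminf_\<beta>_sq_ge) simp
    finally have "b N \<le> (\<Sum>n. (\<beta> n N)\<^sup>2) / real N"
      using elim by (simp add: pos_le_divide_eq)
    then show ?case using elim by simp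
  qed
next
  fix a :: real assume "a > 1"
  moreover have "(\<lambda>N. 1 + inverse (real N)) \<longlonglongrightarrow> 1 + 0"
    by (intro tendsto_intros lim_inverse_n)
  ultimately have "eventually (\<lambda>N. 1 + inverse (real N) < a) sequentially"
    by (intro order_tendstoD) auto
  then show "eventually (\<lambda>N. (\<Sum>n. (\<beta> n N)\<^sup>2) / real N < a) sequentially"
    using eventually_gt_at_top[of 0]
  proof eventually_elim
    case (elim N)
    then have "(\<Sum>n. (\<beta> n N)\<^sup>2) / real N < (real N + 1) / real N"
      by (intro divide_strict_right_mono suminf_\<beta>_sq_less) auto
    also have "\<dots> = 1 + inverse (real N)" using elim by (simp add: field_simps)
    finally show ?case using elim by simp
  qed
qed

section \<open>Shifts and homogeneous elements\<close>

lemma infsum_push: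
  fixes a c :: "nat \<times> nat \<Rightarrow> complex"
  assumes "inj \<phi>"
  shows "(\<Sum>\<^sub>\<infinity>k. (if k \<in> range \<phi> then a (inv \<phi> k) else 0) * c k) = (\<Sum>\<^sub>\<infinity>k. a k * c (\<phi> k))"
proof -
  have "(\<Sum>\<^sub>\<infinity>k. (if k \<in> range \<phi> then a (inv \<phi> k) else 0) * c k) = (\<Sum>\<^sub>\<infinity>k\<in>range \<phi>. a (inv \<phi> k) * c k)"
    by (rule infsum_cong_neutral) auto
  also have "\<dots> = (\<Sum>\<^sub>\<infinity>k. a k * c (\<phi> k))"
    by (simp add: infsum_reindex[OF assms] o_def inv_f_f[OF assms])
  finally show ?thesis .
qed

lemma square_summable_push:
  assumes "inj \<phi>" "square_summable a"
  shows "square_summable (\<lambda>k. if k \<in> range \<phi> then a (inv \<phi> k) else 0)"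
proof -
  have "(\<lambda>k. (cmod (a (inv \<phi> k)))\<^sup>2) summable_on range \<phi>"
    using assms by (simp add: summable_on_reindex o_def inv_f_f square_summable_def)
  moreover have "(\<lambda>k. (cmod (a (inv \<phi> k)))\<^sup>2) summable_on range \<phi> \<longleftrightarrow>
      (\<lambda>k. (cmod (if k \<in> range \<phi> then a (inv \<phi> k) else 0))\<^sup>2) summable_on UNIV"
    by (rule summable_on_cong_neutral) auto
  ultimately show ?thesis by (simp add: square_summable_def)
qed

lemma square_summable_pull:
  assumes "inj \<phi>" "square_summable a"
  shows "square_summable (\<lambda>k. a (\<phi> k))"
proof -
  have "(\<lambda>k. (cmod (a k))\<^sup>2) summable_on range \<phi>"
    using assms(2) unfolding square_summable_def by (rule summable_on_subset_banach) simp
  then show ?thesis using assms(1) by (simp add: summable_on_reindex o_def square_summable_def)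
qed

lemma taylor_push:
  assumes "inj \<phi>" "\<And>x. Rep_hardy2 g x = m x * Rep_hardy2 f x"
    and "\<And>z w k. (case \<phi> k of (i, j) \<Rightarrow> z ^ i * w ^ j) = m (z, w) * (case k of (i, j) \<Rightarrow> z ^ i * w ^ j)"
  shows "taylor g = (\<lambda>k. if k \<in> range \<phi> then taylor f (inv \<phi> k) else 0)"
proof (rule taylor_eqI)
  define b where "b = (\<lambda>k. if k \<in> range \<phi> then taylor f (inv \<phi> k) else 0)"
  show "square_summable (\<lambda>k. if k \<in> range \<phi> then taylor f (inv \<phi> k) else 0)"
    by (rule square_summable_push[OF assms(1) taylor(1)])
  have "Rep_hardy2 g = bidisc_series b"
  proof
    fix x :: "complex \<times> complex"
    obtain z w where x: "x = (z, w)" by (cases x)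
    have "(\<Sum>\<^sub>\<infinity>k. b k * (case k of (i, j) \<Rightarrow> z ^ i * w ^ j))
        = (\<Sum>\<^sub>\<infinity>k. taylor f k * (case \<phi> k of (i, j) \<Rightarrow> z ^ i * w ^ j))"
      unfolding b_def by (rule infsum_push[OF assms(1)])
    also have "\<dots> = m (z, w) * (\<Sum>\<^sub>\<infinity>k. taylor f k * (case k of (i, j) \<Rightarrow> z ^ i * w ^ j))"
      unfolding assms(3) by (simp add: mult.left_commute flip: infsum_cmult_right')
    finally show "Rep_hardy2 g x = bidisc_series b x"
      unfolding assms(2) taylor(2)[of f] by (simp add: x bidisc_series_def case_prod_unfold)
  qed
  then show "Rep_hardy2 g = bidisc_series (\<lambda>k. if k \<in> range \<phi> then taylor f (inv \<phi> k) else 0)"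
    unfolding b_def .
qed

definition up_z :: "nat \<times> nat \<Rightarrow> nat \<times> nat" where "up_z = (\<lambda>(i, j). (Suc i, j))"
definition up_w :: "nat \<times> nat \<Rightarrow> nat \<times> nat" where "up_w = (\<lambda>(i, j). (i, Suc j))"

lemma inj_up: "inj up_z" "inj up_w"
  by (auto simp: inj_def up_z_def up_w_def)

lemma taylor_mult_z_push: "taylor (mult_z f) = (\<lambda>k. if k \<in> range up_z then taylor f (inv up_z k) else 0)"
  by (rule taylor_push[OF inj_up(1), where m = fst]) (auto simp: mult_z.rep_eq up_z_def)

lemma taylor_mult_w_push: "taylor (mult_w f) = (\<lambda>k. if k \<in> range up_w then taylor f (inv up_w k) else 0)"
  by (rule taylor_push[OF inj_up(2), where m = snd]) (auto simp: mult_w.rep_eq up_w_def)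

lemma taylor_mult_z: "taylor (mult_z f) (i, j) = (if i = 0 then 0 else taylor f (i - 1, j))"
proof (cases i)
  case (Suc k)
  then have "(i, j) = up_z (k, j)" by (simp add: up_z_def)
  then show ?thesis using Suc by (simp add: taylor_mult_z_push inv_f_f[OF inj_up(1)])
qed (auto simp: taylor_mult_z_push up_z_def)

lemma taylor_mult_w: "taylor (mult_w f) (i, j) = (if j = 0 then 0 else taylor f (i, j - 1))"
proof (cases j)
  case (Suc k)
  then have "(i, j) = up_w (i, k)" by (simp add: up_w_def)
  then show ?thesis using Suc by (simp add: taylor_mult_w_push inv_f_f[OF inj_up(2)])
qed (auto simp: taylor_mult_w_push up_w_def)

definition back_z :: "hardy2 \<Rightarrow> hardy2" where
  "back_z f = of_taylor (\<lambda>k. taylor f (up_z k))"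

definition back_w :: "hardy2 \<Rightarrow> hardy2" where
  "back_w f = of_taylor (\<lambda>k. taylor f (up_w k))"

lemma taylor_back_z: "taylor (back_z f) (i, j) = taylor f (Suc i, j)"
  unfolding back_z_def
  by (subst taylor_of_taylor[OF square_summable_pull[OF inj_up(1) taylor(1)]]) (simp add: up_z_def)

lemma taylor_back_w: "taylor (back_w f) (i, j) = taylor f (i, Suc j)"
  unfolding back_w_def
  by (subst taylor_of_taylor[OF square_summable_pull[OF inj_up(2) taylor(1)]]) (simp add: up_w_def)

lemma cinner_mult_z: "cinner (mult_z f) g = cinner f (back_z g)"
proof -
  have "cinner (mult_z f) g = (\<Sum>\<^sub>\<infinity>k. taylor f k * cnj (taylor g (up_z k)))"
    unfolding cinner_def taylor_mult_z_push by (rule infsum_push[OF inj_up(1)])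
  also have "\<dots> = cinner f (back_z g)"
    unfolding cinner_def by (rule infsum_cong) (auto simp: up_z_def taylor_back_z)
  finally show ?thesis .
qed

lemma cinner_mult_w: "cinner (mult_w f) g = cinner f (back_w g)"
proof -
  have "cinner (mult_w f) g = (\<Sum>\<^sub>\<infinity>k. taylor f k * cnj (taylor g (up_w k)))"
    unfolding cinner_def taylor_mult_w_push by (rule infsum_push[OF inj_up(2)])
  also have "\<dots> = cinner f (back_w g)"
    unfolding cinner_def by (rule infsum_cong) (auto simp: up_w_def taylor_back_w)
  finally show ?thesis .
qed

lemma cinner_back_z: "cinner (back_z f) g = cinner f (mult_z g)"
  by (metis cinner_commute cinner_mult_z)

lemma cinner_back_w: "cinner (back_w f) g = cinner f (mult_w g)"
  by (metis cinner_commute cinner_mult_w)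

lemma hardy2_eqI: "(\<And>i j. taylor f (i, j) = taylor g (i, j)) \<Longrightarrow> f = g"
  by (metis (no_types, lifting) ext surj_pair taylor_inject)

lemma back_mult: "back_z (mult_z f) = f" "back_w (mult_w f) = f"
  "back_z (mult_w f) = mult_w (back_z f)"
  by (rule hardy2_eqI, simp add: taylor_back_z taylor_back_w taylor_mult_z taylor_mult_w)+

lemma mult_linear:
  "mult_z (f + g) = mult_z f + mult_z g" "mult_z (scaleC c f) = scaleC c (mult_z f)"
  "mult_w (f + g) = mult_w f + mult_w g" "mult_w (scaleC c f) = scaleC c (mult_w f)"
  "mult_z (mult_w f) = mult_w (mult_z f)"
  by (rule hardy2_eqI, simp add: taylor_mult_z taylor_mult_w taylor_simps)+

lemma back_linear:
  "back_z (f + g) = back_z f + back_z g" "back_z (f - g) = back_z f - back_z g"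
  "back_z (scaleC c f) = scaleC c (back_z f)"
  by (rule hardy2_eqI, simp add: taylor_back_z taylor_simps taylor_diff)+

lemma mult_z_sum: "mult_z (sum F I) = (\<Sum>i\<in>I. mult_z (F i))"
proof -
  have "mult_z 0 = 0" using mult_linear(2)[of 0 0] by simp
  then show ?thesis
    by (induction I rule: infinite_finite_induct) (simp_all add: mult_linear)
qed

text \<open>\<open>mult_z\<close> is an isometry, as \<open>back_z\<close> is both its adjoint and
  its left inverse; the adjoint of an isometry is a contraction. This allows \<open>back_z\<close>
  to be applied termwise to series.\<close>

lemma norm_back_z_le: "norm (back_z f) \<le> norm f"
proof -
  have iso: "norm (mult_z g) = norm g" for g
  proof -
    have "complex_of_real ((norm (mult_z g))\<^sup>2) = of_real ((norm g)\<^sup>2)"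
      unfolding cinner_self_norm[symmetric] cinner_mult_z back_mult ..
    then show ?thesis by (simp only: of_real_eq_iff power2_eq_iff_nonneg norm_ge_zero)
  qed
  have "complex_of_real ((norm (back_z f))\<^sup>2) = cinner (mult_z (back_z f)) f"
    by (simp only: cinner_self_norm[symmetric] cinner_mult_z)
  then have "(norm (back_z f))\<^sup>2 = cmod (cinner (mult_z (back_z f)) f)"
    by (metis norm_of_real abs_of_nonneg zero_le_power2)
  also have "\<dots> \<le> norm (back_z f) * norm f"
    using cinner_bound[of "mult_z (back_z f)" f] by (simp add: iso)
  finally show ?thesis
    by (cases "norm (back_z f) = 0") (simp_all add: power2_eq_square)
qed

lemma bounded_linear_back_z: "bounded_linear back_z"
  by (rule bounded_linear_intro[of _ 1])
    (simp_all add: back_linear scaleR_eq_scaleC norm_back_z_le)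

section \<open>Homogeneous elements and their antidiagonal sums\<close>

definition homogeneous_element :: "nat \<Rightarrow> hardy2 \<Rightarrow> bool" where
  "homogeneous_element k f \<longleftrightarrow> (\<forall>i j. taylor f (i, j) \<noteq> 0 \<longrightarrow> i + j = k)"

lemma cinner_homogeneous:
  assumes "homogeneous_element k f"
  shows "cinner f g = (\<Sum>b\<le>k. taylor f (k - b, b) * cnj (taylor g (k - b, b)))"
proof -
  have "cinner f g = (\<Sum>\<^sub>\<infinity>x\<in>(\<lambda>b. (k - b, b)) ` {..k}. taylor f x * cnj (taylor g x))"
    unfolding cinner_def
  proof (rule infsum_cong_neutral)
    fix x assume x: "x \<in> UNIV - (\<lambda>b. (k - b, b)) ` {..k}"
    obtain i j where ij: "x = (i, j)" by (cases x)
    have "taylor f (i, j) = 0"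
    proof (rule ccontr)
      assume "taylor f (i, j) \<noteq> 0"
      then have "i + j = k" using assms by (auto simp: homogeneous_element_def)
      then have "x = (k - j, j)" "j \<le> k" by (auto simp: ij)
      then show False using x by blast
    qed
    then show "taylor f x * cnj (taylor g x) = 0" by (simp add: ij)
  qed auto
  also have "\<dots> = (\<Sum>b\<le>k. taylor f (k - b, b) * cnj (taylor g (k - b, b)))"
    by (subst infsum_finite) (auto simp: sum.reindex inj_on_def)
  finally show ?thesis .
qed

lemma cinner_homogeneous_neq:
  assumes "homogeneous_element k f" "homogeneous_element l g" "k \<noteq> l"
  shows "cinner f g = 0"
  unfolding cinner_homogeneous[OF assms(1)]
proof (rule sum.neutral, rule ballI)
  fix b assume "b \<in> {..k}"
  then have "k - b + b \<noteq> l" using assms(3) by simp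
  then have "taylor g (k - b, b) = 0"
    using assms(2) unfolding homogeneous_element_def by blast
  then show "taylor f (k - b, b) * cnj (taylor g (k - b, b)) = 0" by simp
qed

lemma norm_sq_homogeneous:
  assumes "homogeneous_element k f"
  shows "(norm f)\<^sup>2 = (\<Sum>b\<le>k. (cmod (taylor f (k - b, b)))\<^sup>2)"
proof -
  have "complex_of_real ((norm f)\<^sup>2) = of_real (\<Sum>b\<le>k. (cmod (taylor f (k - b, b)))\<^sup>2)"
    unfolding cinner_self_norm[symmetric] cinner_homogeneous[OF assms]
    by (simp only: complex_norm_square of_real_sum)
  then show ?thesis using of_real_eq_iff by blast
qed

lemma homogeneous_element_back:
  assumes "homogeneous_element (Suc k) f"
  shows "homogeneous_element k (back_z f)" "homogeneous_element k (back_w f)"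
  using assms unfolding homogeneous_element_def taylor_back_z taylor_back_w by fastforce+

text \<open>The shift only loses the pure power of w, a single coefficient within one degree. So the
  norms of the shifts of U_n follow from its norm and its two extreme coefficients.\<close>

lemma norm_sq_back_z_homogeneous:
  assumes "homogeneous_element (Suc k) f"
  shows "(norm (back_z f))\<^sup>2 = (norm f)\<^sup>2 - (cmod (taylor f (0, Suc k)))\<^sup>2"
proof -
  have "(\<Sum>b\<le>k. (cmod (taylor f (Suc (k - b), b)))\<^sup>2) = (\<Sum>b\<le>k. (cmod (taylor f (Suc k - b, b)))\<^sup>2)"
    by (rule sum.cong) (simp_all add: Suc_diff_le)
  then show ?thesis
    unfolding norm_sq_homogeneous[OF assms] norm_sq_homogeneous[OF homogeneous_element_back(1)[OF assms]]
      taylor_back_z sum.atMost_Suc by simp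
qed

lemma norm_sq_back_w_homogeneous:
  assumes "homogeneous_element (Suc k) f"
  shows "(norm (back_w f))\<^sup>2 = (norm f)\<^sup>2 - (cmod (taylor f (Suc k, 0)))\<^sup>2"
  unfolding norm_sq_homogeneous[OF assms] norm_sq_homogeneous[OF homogeneous_element_back(2)[OF assms]]
    taylor_back_w sum.atMost_Suc_shift by simp

section \<open>Quotient modules\<close>

lemma mem_quotient_module:
  "f \<in> quotient_module p \<longleftrightarrow> (\<forall>q. cinner f (poly_hardy2 (p * q)) = 0)"
proof (intro iffI allI)
  fix q assume "f \<in> quotient_module p"
  then have "\<And>g. g \<in> poly_submodule p \<Longrightarrow> cinner f g = 0"
    unfolding quotient_module_def ortho_complement_def by simp
  moreover have "poly_hardy2 (p * q) \<in> poly_submodule p"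
    unfolding poly_submodule_def using closure_subset by (rule subsetD) (rule rangeI)
  ultimately show "cinner f (poly_hardy2 (p * q)) = 0" .
next
  assume f: "\<forall>q. cinner f (poly_hardy2 (p * q)) = 0"
  have "cinner f g = 0" if "g \<in> poly_submodule p" for g
    using _ that unfolding poly_submodule_def by (rule orthogonal_closure) (use f in blast)
  then show "f \<in> quotient_module p" by (simp add: quotient_module_def ortho_complement_def)
qed

lemma subspace_quotient_module: "hardy2.subspace (quotient_module p)"
  unfolding quotient_module_def by (rule subspace_ortho_complement)

lemma closed_quotient_module: "closed (quotient_module p)"
  unfolding quotient_module_def by (rule closed_ortho_complement)

lemma poly_hardy2_eqI:
  assumes "\<And>z w. (z, w) \<in> bidisc \<Longrightarrow> poly_zw p z w = Rep_hardy2 f (z, w)"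
  shows "poly_hardy2 p = f"
proof -
  have "Rep_hardy2 f (z, w) = 0" if "(z, w) \<notin> bidisc" for z w
    unfolding taylor(2)[of f] using that by (simp add: bidisc_series_def)
  then show ?thesis
    using assms unfolding Rep_hardy2_inject[symmetric] poly_hardy2.rep_eq by (auto simp: fun_eq_iff)
qed

lemma poly_hardy2_mult_z: "poly_hardy2 ([:[:0, 1:]:] * p) = mult_z (poly_hardy2 p)"
  by (rule poly_hardy2_eqI) (simp add: poly_zw_def mult_z.rep_eq poly_hardy2.rep_eq)

lemma poly_hardy2_mult_w: "poly_hardy2 ([:0, 1:] * p) = mult_w (poly_hardy2 p)"
  by (rule poly_hardy2_eqI) (simp add: poly_zw_def mult_w.rep_eq poly_hardy2.rep_eq)

lemma poly_hardy2_add: "poly_hardy2 (p + q) = poly_hardy2 p + poly_hardy2 q"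
  by (rule poly_hardy2_eqI) (simp add: poly_zw_def plus_hardy2.rep_eq poly_hardy2.rep_eq)

lemma poly_hardy2_scaleC: "poly_hardy2 ([:[:c:]:] * p) = scaleC c (poly_hardy2 p)"
  by (rule poly_hardy2_eqI) (simp add: poly_zw_def scaleC.rep_eq poly_hardy2.rep_eq)

text \<open>Multiples of \<open>p\<close> stay multiples under multiplication by z, so the adjoint
  shift preserves their orthogonal complement.\<close>

lemma back_z_mem_quotient_module:
  assumes "f \<in> quotient_module p"
  shows "back_z f \<in> quotient_module p"
  unfolding mem_quotient_module
proof
  fix q
  have "mult_z (poly_hardy2 (p * q)) = poly_hardy2 (p * ([:[:0, 1:]:] * q))"
    by (simp only: poly_hardy2_mult_z[symmetric] mult_ac)
  then show "cinner (back_z f) (poly_hardy2 (p * q)) = 0"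
    using assms unfolding cinner_back_z mem_quotient_module by metis
qed

lemma adjoint_S_z:
  assumes g: "g \<in> quotient_module p"
  shows "adjoint_on (quotient_module p) (S_z p) g = back_z g"
proof (rule adjoint_on_eqI[OF subspace_quotient_module back_z_mem_quotient_module[OF g]])
  fix f assume "f \<in> quotient_module p"
  show "cinner (S_z p f) g = cinner f (back_z g)"
    unfolding S_z_def compression_def
    by (simp add: proj_on(2)[OF subspace_quotient_module closed_quotient_module g] cinner_mult_z)
qed

lemma S_w_mem: "S_w p f \<in> quotient_module p"
  unfolding S_w_def compression_def
  by (rule proj_on(1)[OF subspace_quotient_module closed_quotient_module])

lemma cross_commutator_eq:
  assumes "f \<in> quotient_module p"
  shows "cross_commutator p f = back_z (S_w p f) - S_w p (back_z f)"
  using assms by (simp add: cross_commutator_def adjoint_S_z S_w_mem)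

section \<open>The multiples of the power of the diagonal\<close>

text \<open>z^i w^j (z - w)^N, written with iterated shifts so that the rules for
  \<open>mult_z\<close>, \<open>mult_w\<close> and their adjoints apply directly.\<close>

definition diag_shift :: "nat \<Rightarrow> nat \<Rightarrow> nat \<Rightarrow> hardy2" where
  "diag_shift N i j = (mult_z ^^ i) ((mult_w ^^ j) (poly_hardy2 (p_diag N)))"

lemma diag_shift_Suc:
  "mult_z (diag_shift N i j) = diag_shift N (Suc i) j"
  "mult_w (diag_shift N i j) = diag_shift N i (Suc j)"
proof -
  show "mult_z (diag_shift N i j) = diag_shift N (Suc i) j" by (simp add: diag_shift_def)
  have "mult_w ((mult_z ^^ i) f) = (mult_z ^^ i) (mult_w f)" for f
    by (induction i) (simp_all add: mult_linear(5)[symmetric])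
  then show "mult_w (diag_shift N i j) = diag_shift N i (Suc j)"
    by (simp add: diag_shift_def)
qed

text \<open>The span is stable under both shifts, so induction over the two layers of
  \<open>complex poly poly\<close> applies: coefficients in z first, then powers of w.\<close>

lemma poly_hardy2_p_diag_mem_span:
  "poly_hardy2 (p_diag N * q) \<in> hardy2.span (range (\<lambda>(i, j). diag_shift N i j))" (is "_ \<in> ?V")
proof -
  have V: "mult_z f \<in> ?V \<and> mult_w f \<in> ?V" if "f \<in> ?V" for f
    using that
  proof (induction rule: hardy2.span_induct_alt)
    case base
    have "mult_z 0 = 0" "mult_w 0 = 0"
      using mult_linear(2)[of 0 0] mult_linear(4)[of 0 0] by simp_all
    then show ?case by (simp add: hardy2.span_zero)
  next
    case (step c x y)
    then obtain i j where "x = diag_shift N i j" by auto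
    then have "mult_z x = (\<lambda>(i, j). diag_shift N i j) (Suc i, j)"
      "mult_w x = (\<lambda>(i, j). diag_shift N i j) (i, Suc j)"
      by (simp_all add: diag_shift_Suc)
    then have "mult_z x \<in> ?V" "mult_w x \<in> ?V"
      by (metis hardy2.span_base rangeI)+
    then show ?case
      using step(2) by (auto simp: mult_linear intro!: hardy2.span_add hardy2.span_scale)
  qed
  have p: "poly_hardy2 (p_diag N) \<in> ?V"
    by (rule hardy2.span_base) (auto simp: diag_shift_def intro!: image_eqI[of _ _ "(0, 0)"])
  have zero: "poly_hardy2 0 = 0"
    using poly_hardy2_scaleC[of 0 0] by simp
  have c: "poly_hardy2 (p_diag N * [:c:]) \<in> ?V" for c
  proof (induction c)
    case 0
    then show ?case by (simp add: zero hardy2.span_zero)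
  next
    case (pCons a c)
    have e: "[:pCons a c:] = [:[:a:]:] + [:[:0, 1:]:] * [:c:]" by simp
    have "p_diag N * [:pCons a c:] = [:[:a:]:] * p_diag N + [:[:0, 1:]:] * (p_diag N * [:c:])"
      unfolding e by (simp only: algebra_simps)
    then have "poly_hardy2 (p_diag N * [:pCons a c:])
        = scaleC a (poly_hardy2 (p_diag N)) + mult_z (poly_hardy2 (p_diag N * [:c:]))"
      by (simp only: poly_hardy2_add poly_hardy2_mult_z poly_hardy2_scaleC)
    then show ?case using V pCons.IH p by (auto intro!: hardy2.span_add hardy2.span_scale)
  qed
  show ?thesis
  proof (induction q)
    case 0
    then show ?case by (simp add: zero hardy2.span_zero)
  next
    case (pCons a q)
    have "p_diag N * pCons a q = p_diag N * [:a:] + [:0, 1:] * (p_diag N * q)"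
      by (simp add: algebra_simps)
    then have "poly_hardy2 (p_diag N * pCons a q)
        = poly_hardy2 (p_diag N * [:a:]) + mult_w (poly_hardy2 (p_diag N * q))"
      by (simp only: poly_hardy2_add poly_hardy2_mult_w)
    then show ?case using V pCons.IH c by (auto intro!: hardy2.span_add)
  qed
qed

lemma diag_shift_eq_poly: "\<exists>q. diag_shift N i j = poly_hardy2 (p_diag N * q)"
proof -
  have "\<exists>q. (mult_w ^^ j) (poly_hardy2 (p_diag N)) = poly_hardy2 (p_diag N * q)"
  proof (induction j)
    case 0
    show ?case by (rule exI[of _ 1]) simp
  next
    case (Suc j)
    then obtain q where "(mult_w ^^ j) (poly_hardy2 (p_diag N)) = poly_hardy2 (p_diag N * q)" by blast
    then show ?case
      by (intro exI[of _ "[:0, 1:] * q"])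
        (simp only: funpow.simps o_apply poly_hardy2_mult_w[symmetric] mult.left_commute)
  qed
  then obtain q where q: "(mult_w ^^ j) (poly_hardy2 (p_diag N)) = poly_hardy2 (p_diag N * q)" by blast
  show ?thesis
    unfolding diag_shift_def q
  proof (induction i)
    case 0
    show ?case by auto
  next
    case (Suc i)
    then obtain r where "(mult_z ^^ i) (poly_hardy2 (p_diag N * q)) = poly_hardy2 (p_diag N * r)" by blast
    then show ?case
      by (intro exI[of _ "[:[:0, 1:]:] * r"])
        (simp only: funpow.simps o_apply poly_hardy2_mult_z[symmetric] mult.left_commute)
  qed
qed

lemma mem_quotient_p_diag:
  "f \<in> quotient_module (p_diag N) \<longleftrightarrow> (\<forall>i j. cinner f (diag_shift N i j) = 0)"
proof
  assume "f \<in> quotient_module (p_diag N)"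
  then show "\<forall>i j. cinner f (diag_shift N i j) = 0"
    unfolding mem_quotient_module using diag_shift_eq_poly by metis
next
  assume f: "\<forall>i j. cinner f (diag_shift N i j) = 0"
  then show "f \<in> quotient_module (p_diag N)"
    unfolding mem_quotient_module
    by (intro allI orthogonal_span[OF _ poly_hardy2_p_diag_mem_span]) auto
qed

lemma taylor_poly_hardy2_1: "taylor (poly_hardy2 1) (i, j) = (if i = 0 \<and> j = 0 then 1 else 0)"
proof -
  let ?a = "\<lambda>k :: nat \<times> nat. if k = (0, 0) then 1 else 0 :: complex"
  have "taylor (poly_hardy2 1) = ?a"
  proof (rule taylor_eqI)
    have "(\<lambda>k. (cmod (?a k))\<^sup>2) summable_on {(0, 0)} \<longleftrightarrow> (\<lambda>k. (cmod (?a k))\<^sup>2) summable_on UNIV"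
      by (rule summable_on_cong_neutral) auto
    then show "square_summable ?a" by (simp add: square_summable_def)
    have "(\<Sum>\<^sub>\<infinity>k. ?a k * (case k of (i, j) \<Rightarrow> z ^ i * w ^ j))
        = (\<Sum>\<^sub>\<infinity>k\<in>{(0, 0)}. ?a k * (case k of (i, j) \<Rightarrow> z ^ i * w ^ j))" for z w
      by (rule infsum_cong_neutral) auto
    then show "Rep_hardy2 (poly_hardy2 1) = bidisc_series ?a"
      by (auto simp: poly_hardy2.rep_eq poly_zw_def bidisc_series_def case_prod_unfold fun_eq_iff prod_eq_iff)
  qed
  then show ?thesis by auto
qed

lemma taylor_p_diag:
  "taylor (poly_hardy2 (p_diag N)) (a, b) = (if a + b = N then (-1) ^ b * of_nat (N choose b) else 0)"
proof (induction N arbitrary: a b)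
  case 0
  then show ?case by (simp add: p_diag_def taylor_poly_hardy2_1)
next
  case (Suc N)
  have "p_diag (Suc N) = [:[:0, 1:]:] * p_diag N + [:[:-1:]:] * ([:0, 1:] * p_diag N)"
  proof -
    have "[:[:-1:]:] = (-1 :: complex poly poly)" by (simp add: one_pCons)
    then show ?thesis
      by (simp only: p_diag_def power_Suc left_diff_distrib mult_minus1 add_uminus_conv_diff)
  qed
  then have eq: "poly_hardy2 (p_diag (Suc N))
      = mult_z (poly_hardy2 (p_diag N)) + scaleC (-1) (mult_w (poly_hardy2 (p_diag N)))"
    by (simp only: poly_hardy2_add poly_hardy2_mult_z poly_hardy2_mult_w poly_hardy2_scaleC)
  have "taylor (poly_hardy2 (p_diag (Suc N))) (a, b)
      = (if a = 0 then 0 else taylor (poly_hardy2 (p_diag N)) (a - 1, b))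
        - (if b = 0 then 0 else taylor (poly_hardy2 (p_diag N)) (a, b - 1))"
    unfolding eq taylor_simps taylor_mult_z taylor_mult_w by simp
  also have "\<dots> = (if a + b = Suc N then (-1) ^ b * of_nat (Suc N choose b) else 0)"
    unfolding Suc.IH by (cases a; cases b) (auto simp: algebra_simps binomial_eq_0)
  finally show ?case .
qed

lemma taylor_diag_shift:
  "taylor (diag_shift N i j) (a, b)
    = (if a + b = i + j + N \<and> j \<le> b then (-1) ^ (b - j) * of_nat (N choose (b - j)) else 0)"
proof -
  have z: "taylor ((mult_z ^^ i) f) (a, b) = (if a < i then 0 else taylor f (a - i, b))" for f
    by (induction i arbitrary: a) (auto simp: taylor_mult_z)
  have w: "taylor ((mult_w ^^ j) f) (a, b) = (if b < j then 0 else taylor f (a, b - j))" for f a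
    by (induction j arbitrary: b) (auto simp: taylor_mult_w)
  show ?thesis
    unfolding diag_shift_def z w taylor_p_diag by (auto simp: binomial_eq_0)
qed

lemma homogeneous_diag_shift: "homogeneous_element (i + j + N) (diag_shift N i j)"
  by (simp add: homogeneous_element_def taylor_diag_shift)

text \<open>Vandermonde's identity after reflecting one factor, \<open>N choose (b - j')\<close> =
  \<open>N choose (N + j' - b)\<close>. The bound on \<open>M\<close> makes the range contain the
  whole support.\<close>

lemma sum_choose_shifted:
  assumes "j' + N \<le> M"
  shows "(\<Sum>b\<le>M. if j \<le> b \<and> j' \<le> b then (N choose (b - j)) * (N choose (b - j')) else 0)
    = (if j \<le> N + j' then (2 * N) choose (N + j' - j) else 0)"
proof (cases "j \<le> N + j'")
  case True
  have "(\<Sum>b\<le>M. if j \<le> b \<and> j' \<le> b then (N choose (b - j)) * (N choose (b - j')) else 0)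
      = (\<Sum>b=j..N + j'. (N choose (b - j)) * (N choose (N + j' - b)))"
  proof (rule sum.mono_neutral_cong)
    fix b assume b: "b \<in> {..M} \<inter> {j..N + j'}"
    show "(if j \<le> b \<and> j' \<le> b then (N choose (b - j)) * (N choose (b - j')) else 0)
      = (N choose (b - j)) * (N choose (N + j' - b))"
    proof (cases "j' \<le> b")
      case True
      then have "N + j' - b = N - (b - j')" by simp
      moreover have "b - j' \<le> N" using b by auto
      ultimately have "N choose (N + j' - b) = N choose (b - j')"
        using binomial_symmetric[of "b - j'" N] by metis
      then show ?thesis using b True by simp
    qed (simp add: binomial_eq_0)
  qed (use assms in \<open>auto simp: binomial_eq_0\<close>)
  also have "\<dots> = (\<Sum>l\<le>N + j' - j. (N choose l) * (N choose (N + j' - j - l)))"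
    by (rule sum.reindex_bij_witness[of _ "\<lambda>l. l + j" "\<lambda>b. b - j"]) (use True in auto)
  also have "\<dots> = (N + N) choose (N + j' - j)" by (rule vandermonde)
  finally show ?thesis using True by (simp add: mult_2)
next
  case False
  then show ?thesis by (auto simp: binomial_eq_0 intro!: sum.neutral)
qed

lemma cinner_diag_shift:
  assumes "i + j = i' + j'"
  shows "cinner (diag_shift N i j) (diag_shift N i' j') = of_real (diag_gram N j' j)"
proof -
  have "cinner (diag_shift N i j) (diag_shift N i' j') = (\<Sum>b\<le>i + j + N. (-1) ^ (j' + j)
      * of_nat (if j \<le> b \<and> j' \<le> b then (N choose (b - j)) * (N choose (b - j')) else 0))"
    unfolding cinner_homogeneous[OF homogeneous_diag_shift]
  proof (rule sum.cong)
    fix b assume b: "b \<in> {..i + j + N}"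
    have "(-1 :: complex) ^ (b - j) * (-1) ^ (b - j') = (-1) ^ (j' + j)" if "j \<le> b" "j' \<le> b"
      using that by (simp add: minus_one_power_iff)
    then show "taylor (diag_shift N i j) (i + j + N - b, b) * cnj (taylor (diag_shift N i' j') (i + j + N - b, b))
      = (-1) ^ (j' + j) * of_nat (if j \<le> b \<and> j' \<le> b then (N choose (b - j)) * (N choose (b - j')) else 0)"
      using b assms by (simp add: taylor_diag_shift mult_ac)
  qed simp
  also have "\<dots> = (-1) ^ (j' + j)
      * of_nat (\<Sum>b\<le>i + j + N. if j \<le> b \<and> j' \<le> b then (N choose (b - j)) * (N choose (b - j')) else 0)"
    by (simp only: sum_distrib_left of_nat_sum)
  also have "\<dots> = of_real (diag_gram N j' j)"
    using assms by (subst sum_choose_shifted) (simp_all add: diag_gram_def)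
  finally show ?thesis .
qed

section \<open>The expansion of the commutator\<close>

text \<open>\<open>diag_ortho N n\<close> spans the part of degree \<open>n + N\<close> of \<open>[p\<^sub>N] \<ominus> w [p\<^sub>N]\<close>.\<close>

definition diag_ortho :: "nat \<Rightarrow> nat \<Rightarrow> hardy2" where
  "diag_ortho N n = (\<Sum>j\<le>n. scaleC (of_real (ortho_coeff N n j)) (diag_shift N (n - j) j))"

text \<open>Represents the functional sending f to the inner product of w f with U_n.\<close>

definition right_vector :: "nat \<Rightarrow> nat \<Rightarrow> hardy2" where
  "right_vector N n = back_w (diag_ortho N n)"

text \<open>One term from each projection in the commutator; at \<open>n = 0\<close> the
  index-shifted one is absent. The quotient of the t's is also the coefficient of the projection of
  \<open>back_z (diag_ortho N n)\<close> to \<open>diag_ortho N (n - 1)\<close>, so the vector is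
  orthogonal to the latter.\<close>

definition left_vector :: "nat \<Rightarrow> nat \<Rightarrow> hardy2" where
  "left_vector N n = back_z (diag_ortho N n) - (if n = 0 then 0
    else scaleC (of_real (t_coeff (n - 1) N / t_coeff n N)) (diag_ortho N (n - 1)))"

lemma taylor_sum: "taylor (sum F I) k = (\<Sum>i\<in>I. taylor (F i) k)"
  by (induction I rule: infinite_finite_induct) (simp_all add: taylor_simps)

lemma homogeneous_element_scaleC: "homogeneous_element k f \<Longrightarrow> homogeneous_element k (scaleC c f)"
  by (simp add: homogeneous_element_def taylor_simps)

lemma homogeneous_element_diff:
  "homogeneous_element k f \<Longrightarrow> homogeneous_element k g \<Longrightarrow> homogeneous_element k (f - g)"
  unfolding homogeneous_element_def taylor_diff by (metis diff_self)

lemma homogeneous_diag_ortho: "homogeneous_element (n + N) (diag_ortho N n)"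
  unfolding homogeneous_element_def
proof (intro allI impI)
  fix a b assume "taylor (diag_ortho N n) (a, b) \<noteq> 0"
  then obtain j where "j \<le> n" "taylor (diag_shift N (n - j) j) (a, b) \<noteq> 0"
    unfolding diag_ortho_def taylor_sum taylor_scaleC
    by (metis (no_types, lifting) atMost_iff mult_zero_right sum.neutral)
  then show "a + b = n + N"
    using homogeneous_diag_shift[of "n - j" j N] by (auto simp: homogeneous_element_def)
qed

lemma diag_ortho_orthogonal: "m \<noteq> n \<Longrightarrow> cinner (diag_ortho N m) (diag_ortho N n) = 0"
  by (rule cinner_homogeneous_neq[OF homogeneous_diag_ortho homogeneous_diag_ortho]) simp

text \<open>Across degrees this is homogeneity, within degree \<open>n + N\<close> it is the
  orthogonality relation for the Gram matrix. The cases \<open>j > 0\<close> express orthogonality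
  to w [p].\<close>

lemma cinner_diag_ortho_shift:
  assumes "N \<ge> 1"
  shows "cinner (diag_ortho N n) (diag_shift N i j)
    = (if i = n \<and> j = 0 then of_real (1 / t_coeff n N) else 0)"
proof (cases "i + j = n")
  case True
  then have "cinner (diag_ortho N n) (diag_shift N i j)
      = of_real (\<Sum>l\<le>n. ortho_coeff N n l * diag_gram N j l)"
    unfolding diag_ortho_def cinner_sum_left cinner_scaleC_left of_real_sum of_real_mult
    by (intro sum.cong arg_cong2[where f = "(*)"] cinner_diag_shift) auto
  also have "\<dots> = of_real (if j = 0 then 1 / t_coeff n N else 0)"
    using True by (subst ortho_coeff_diag_gram[OF assms]) auto
  finally show ?thesis using True by auto
next
  case False
  then show ?thesis
    using cinner_homogeneous_neq[OF homogeneous_diag_ortho homogeneous_diag_shift, of n N i j N] by auto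
qed

lemma cinner_diag_ortho_expand:
  "cinner f (diag_ortho N n) = (\<Sum>j\<le>n. of_real (ortho_coeff N n j) * cinner f (diag_shift N (n - j) j))"
  by (simp add: diag_ortho_def cinner_simps)

text \<open>Modulo w [p], U_n is z^n p because its first coefficient is 1, and z U_n is z^(n+1) p.
  Comparing the second statement with the first at \<open>Suc n\<close> links neighbouring
  degrees.\<close>

lemma cinner_diag_ortho_first:
  assumes "\<And>i j. cinner f (diag_shift N i (Suc j)) = 0"
  shows "cinner f (diag_ortho N n) = cinner f (diag_shift N n 0)"
    and "cinner f (mult_z (diag_ortho N n)) = cinner f (diag_shift N (Suc n) 0)"
proof -
  have 0: "cinner f (diag_shift N i j) = 0" if "j \<noteq> 0" for i j
    using assms[of i "j - 1"] that by simp
  have "cinner f (diag_ortho N n)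
      = (\<Sum>j\<le>n. if j = 0 then cinner f (diag_shift N n 0) else 0)"
    unfolding cinner_diag_ortho_expand by (rule sum.cong) (auto simp: 0 ortho_coeff_0)
  then show "cinner f (diag_ortho N n) = cinner f (diag_shift N n 0)" by simp
  have "cinner f (mult_z (diag_ortho N n))
      = (\<Sum>j\<le>n. if j = 0 then cinner f (diag_shift N (Suc n) 0) else 0)"
    unfolding diag_ortho_def mult_z_sum mult_linear diag_shift_Suc cinner_sum_right cinner_scaleC_right
    by (rule sum.cong) (auto simp: 0 ortho_coeff_0)
  then show "cinner f (mult_z (diag_ortho N n)) = cinner f (diag_shift N (Suc n) 0)" by simp
qed

lemma norm_sq_diag_ortho:
  assumes "N \<ge> 1"
  shows "(norm (diag_ortho N n))\<^sup>2 = 1 / t_coeff n N"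
proof -
  have "complex_of_real ((norm (diag_ortho N n))\<^sup>2) = of_real (1 / t_coeff n N)"
    unfolding cinner_self_norm[symmetric]
    by (subst cinner_diag_ortho_first) (simp_all add: cinner_diag_ortho_shift[OF assms])
  then show ?thesis using of_real_eq_iff by blast
qed

lemma diag_ortho_nonzero: "N \<ge> 1 \<Longrightarrow> diag_ortho N n \<noteq> 0"
  using norm_sq_diag_ortho[of N n] t_coeff_pos[of n N] by auto

text \<open>Only the summand \<open>j = 0\<close> contains the pure power of z and only
  \<open>j = n\<close> the pure power of w, so the first and the last orthogonal coefficient
  appear.\<close>

lemma taylor_diag_ortho_corners:
  assumes "N \<ge> 1"
  shows "taylor (diag_ortho N n) (n + N, 0) = 1"
    and "cmod (taylor (diag_ortho N n) (0, n + N)) = real N / real (n + N)"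
proof -
  have "taylor (diag_ortho N n) (n + N, 0) = (\<Sum>j\<le>n. if j = 0 then 1 else 0)"
    unfolding diag_ortho_def taylor_sum taylor_scaleC
    by (rule sum.cong) (auto simp: taylor_diag_shift ortho_coeff_0)
  then show "taylor (diag_ortho N n) (n + N, 0) = 1" by simp
  have "taylor (diag_ortho N n) (0, n + N)
      = (\<Sum>j\<le>n. if j = n then of_real (real N / real (n + N)) * (-1) ^ N else 0)"
    unfolding diag_ortho_def taylor_sum taylor_scaleC
    by (rule sum.cong) (auto simp: taylor_diag_shift ortho_coeff_last[OF assms] binomial_eq_0)
  then show "cmod (taylor (diag_ortho N n) (0, n + N)) = real N / real (n + N)"
    by (simp add: norm_mult norm_power norm_divide del: of_nat_add)
qed

lemma norm_sq_right_vector: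
  assumes "N \<ge> 1"
  shows "(norm (right_vector N n))\<^sup>2 = 1 / t_coeff n N - 1"
proof -
  obtain k where k: "n + N = Suc k" using assms by (cases "n + N") auto
  have "(norm (right_vector N n))\<^sup>2
      = (norm (diag_ortho N n))\<^sup>2 - (cmod (taylor (diag_ortho N n) (n + N, 0)))\<^sup>2"
    unfolding right_vector_def k
    by (rule norm_sq_back_w_homogeneous) (use homogeneous_diag_ortho[of n N] k in simp)
  then show ?thesis by (simp add: taylor_diag_ortho_corners(1)[OF assms] norm_sq_diag_ortho[OF assms])
qed

lemma norm_sq_back_z_diag_ortho:
  assumes "N \<ge> 1"
  shows "(norm (back_z (diag_ortho N n)))\<^sup>2 = 1 / t_coeff n N - (real N / real (n + N))\<^sup>2"
proof -
  obtain k where k: "n + N = Suc k" using assms by (cases "n + N") auto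
  have "(norm (back_z (diag_ortho N n)))\<^sup>2
      = (norm (diag_ortho N n))\<^sup>2 - (cmod (taylor (diag_ortho N n) (0, n + N)))\<^sup>2"
    unfolding k
    by (rule norm_sq_back_z_homogeneous) (use homogeneous_diag_ortho[of n N] k in simp)
  then show ?thesis by (simp only: taylor_diag_ortho_corners(2)[OF assms] norm_sq_diag_ortho[OF assms])
qed

lemma norm_sq_diff_scaleC:
  assumes "cinner x y = of_real a"
  shows "(norm (x - scaleC (of_real r) y))\<^sup>2 = (norm x)\<^sup>2 - 2 * r * a + r\<^sup>2 * (norm y)\<^sup>2"
proof -
  have "cinner y x = of_real a" using assms by (subst cinner_commute) simp
  then have "cinner (x - scaleC (of_real r) y) (x - scaleC (of_real r) y)
      = of_real ((norm x)\<^sup>2 - 2 * r * a + r\<^sup>2 * (norm y)\<^sup>2)"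
    using assms unfolding cinner_simps by (simp add: cinner_self_norm power2_eq_square algebra_simps)
  then show ?thesis unfolding cinner_self_norm using of_real_eq_iff by blast
qed

text \<open>Since the subtracted term is a projection, it removes r / t_n with r = t_(n-1) / t_n.
  The recursion r = 1 - (N/(n+N))^2 then makes the factor 1/t_n - 1 appear.\<close>

lemma norm_sq_left_vector:
  assumes "N \<ge> 1"
  shows "(norm (left_vector N n))\<^sup>2 = (real N / real (n + N))\<^sup>2 * (1 / t_coeff n N - 1)"
proof (cases n)
  case 0
  then show ?thesis
    using norm_sq_back_z_diag_ortho[OF assms, of 0] assms by (simp add: left_vector_def)
next
  case (Suc m)
  define r where "r = t_coeff m N / t_coeff n N"
  have "cinner (diag_ortho N n) (mult_z (diag_ortho N m)) = of_real (1 / t_coeff n N)"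
    by (subst cinner_diag_ortho_first(2)) (simp_all add: cinner_diag_ortho_shift[OF assms] Suc)
  then have "(norm (left_vector N n))\<^sup>2
      = (norm (back_z (diag_ortho N n)))\<^sup>2 - 2 * r * (1 / t_coeff n N) + r\<^sup>2 * (norm (diag_ortho N m))\<^sup>2"
    using norm_sq_diff_scaleC[of "back_z (diag_ortho N n)" "diag_ortho N m" "1 / t_coeff n N" r]
    by (simp add: left_vector_def Suc r_def cinner_back_z)
  also have "r\<^sup>2 * (norm (diag_ortho N m))\<^sup>2 = r * (1 / t_coeff n N)"
    unfolding norm_sq_diag_ortho[OF assms] r_def
    using t_coeff_pos[of m N] by (simp add: power2_eq_square)
  also have "r = 1 - (real N / real (n + N))\<^sup>2"
    using t_coeff_ratio[of m N] by (simp add: r_def Suc)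
  finally show ?thesis
    by (simp add: norm_sq_back_z_diag_ortho[OF assms] algebra_simps diff_divide_distrib)
qed

lemma right_vector_mem: "N \<ge> 1 \<Longrightarrow> right_vector N n \<in> quotient_module (p_diag N)"
  unfolding mem_quotient_p_diag right_vector_def cinner_back_w diag_shift_Suc
  by (simp add: cinner_diag_ortho_shift)

lemma homogeneous_right_vector:
  assumes "N \<ge> 1"
  shows "homogeneous_element (n + N - 1) (right_vector N n)"
  unfolding right_vector_def
  by (rule homogeneous_element_back) (use homogeneous_diag_ortho[of n N] assms in simp)

lemma homogeneous_left_vector:
  assumes "N \<ge> 1"
  shows "homogeneous_element (n + N - 1) (left_vector N n)"
proof -
  have 1: "homogeneous_element (n + N - 1) (back_z (diag_ortho N n))"
    by (rule homogeneous_element_back) (use homogeneous_diag_ortho[of n N] assms in simp)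
  show ?thesis
  proof (cases n)
    case 0
    then show ?thesis using 1 by (simp add: left_vector_def)
  next
    case (Suc m)
    then show ?thesis
      using 1 homogeneous_diag_ortho[of m N] unfolding left_vector_def
      by (auto intro!: homogeneous_element_diff homogeneous_element_scaleC)
  qed
qed

lemma left_right_vector_orthogonal:
  assumes "N \<ge> 1" "m \<noteq> n"
  shows "cinner (right_vector N m) (right_vector N n) = 0"
    and "cinner (left_vector N m) (left_vector N n) = 0"
  by (rule cinner_homogeneous_neq[OF homogeneous_right_vector homogeneous_right_vector]
      cinner_homogeneous_neq[OF homogeneous_left_vector homogeneous_left_vector], use assms in simp_all)+

text \<open>Both squared norms contain the factor 1/t - 1, and t (1/t - 1) = 1 - t. Squares are
  compared because both sides are nonnegative.\<close>

lemma norm_left_right_vector: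
  assumes "N \<ge> 1"
  shows "norm (right_vector N n) * norm (scaleC (of_real (- t_coeff n N)) (left_vector N n)) = \<beta> n N"
proof -
  let ?t = "t_coeff n N" and ?c = "real N / real (n + N)"
  have t: "?t > 0" by (rule t_coeff_pos)
  have "(norm (right_vector N n) * norm (scaleC (of_real (- ?t)) (left_vector N n)))\<^sup>2
      = ?t\<^sup>2 * (norm (right_vector N n))\<^sup>2 * (norm (left_vector N n))\<^sup>2"
    by (simp add: norm_scaleC power_mult_distrib mult_ac)
  also have "\<dots> = (?t * (1 / ?t - 1))\<^sup>2 * ?c\<^sup>2"
    unfolding norm_sq_right_vector[OF assms] norm_sq_left_vector[OF assms]
    by (simp only: power2_eq_square mult_ac)
  also have "?t * (1 / ?t - 1) = 1 - ?t" using t by (simp add: right_diff_distrib)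
  also have "(1 - ?t)\<^sup>2 * ?c\<^sup>2 = (\<beta> n N)\<^sup>2"
    by (simp only: \<beta>_eq[OF assms] power_mult_distrib mult.commute)
  finally show ?thesis
    using \<beta>_pos[OF assms, of n] by (simp only: power2_eq_iff_nonneg norm_ge_zero mult_nonneg_nonneg less_imp_le)
qed

section \<open>The projection of w f and the series of the commutator\<close>

lemma cinner_mult_w_diag_shift:
  assumes "f \<in> quotient_module (p_diag N)"
  shows "cinner (mult_w f) (diag_shift N i (Suc j)) = 0"
  using assms unfolding diag_shift_Suc(2)[symmetric] cinner_mult_w back_mult mem_quotient_p_diag by blast

lemma cinner_diag_ortho_quotient:
  assumes "f \<in> quotient_module (p_diag N)"
  shows "cinner (diag_ortho N n) f = 0"
proof -
  have "cinner f (diag_ortho N n) = 0"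
    using assms by (simp add: cinner_diag_ortho_expand mem_quotient_p_diag)
  then show ?thesis by (simp add: cinner_eq_0_commute)
qed

text \<open>The series is the orthogonal expansion of the projection of w f to [p], with
  \<open>t_coeff n N\<close> as the reciprocal of the squared norm of U_n. It is identified by two
  tests: w f minus the sum is orthogonal to all z^i w^j p, and the sum is orthogonal to Q.\<close>

lemma S_w_sums:
  assumes N: "N \<ge> 1" and f: "f \<in> quotient_module (p_diag N)"
  shows "(\<lambda>n. scaleC (of_real (t_coeff n N) * cinner f (right_vector N n)) (diag_ortho N n))
    sums (mult_w f - S_w (p_diag N) f)"
proof -
  let ?F = "\<lambda>n. scaleC (of_real (t_coeff n N) * cinner f (right_vector N n)) (diag_ortho N n)"
  have fU: "cinner f (right_vector N n) = cinner (mult_w f) (diag_ortho N n)" for n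
    by (simp add: right_vector_def cinner_mult_w)
  have "summable ?F"
  proof (rule summable_orthogonal)
    show "cinner (?F i) (?F j) = 0" if "i \<noteq> j" for i j
      using that by (simp add: cinner_simps diag_ortho_orthogonal)
    have "(norm (?F n))\<^sup>2 = (cmod (cinner (mult_w f) (diag_ortho N n)))\<^sup>2 / (norm (diag_ortho N n))\<^sup>2" for n
      unfolding fU norm_scaleC norm_mult power_mult_distrib norm_sq_diag_ortho[OF N]
      by (simp add: power2_eq_square)
    then show "summable (\<lambda>n. (norm (?F n))\<^sup>2)"
      using summable_bessel[where A = "diag_ortho N" and f = "mult_w f"] diag_ortho_orthogonal
        diag_ortho_nonzero[OF N] by simp
  qed
  then obtain R where R: "?F sums R" by (auto simp: summable_def)
  have "S_w (p_diag N) f = mult_w f - R"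
    unfolding S_w_def compression_def
  proof (rule proj_on_eqI[OF subspace_quotient_module])
    show "mult_w f - R \<in> quotient_module (p_diag N)"
      unfolding mem_quotient_p_diag
    proof (intro allI)
      fix i j
      have "(\<lambda>n. cinner (?F n) (diag_shift N i j)) sums cinner R (diag_shift N i j)"
        by (rule sums_cinner_left[OF R])
      moreover have "cinner (?F n) (diag_shift N i j)
          = (if n = i then (if j = 0 then cinner (mult_w f) (diag_ortho N n) else 0) else 0)" for n
        using t_coeff_pos[of n N] by (auto simp: cinner_scaleC_left cinner_diag_ortho_shift[OF N] fU)
      ultimately have "cinner R (diag_shift N i j) = (if j = 0 then cinner (mult_w f) (diag_ortho N i) else 0)"
        using sums_single[of i "\<lambda>n. if j = 0 then cinner (mult_w f) (diag_ortho N n) else 0"]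
          sums_unique2 by fastforce
      also have "\<dots> = cinner (mult_w f) (diag_shift N i j)"
        using cinner_diag_ortho_first(1)[OF cinner_mult_w_diag_shift[OF f], of i]
          cinner_mult_w_diag_shift[OF f, of i "j - 1"] by auto
      finally show "cinner (mult_w f - R) (diag_shift N i j) = 0"
        by (simp add: cinner_diff_left)
    qed
    fix h assume h: "h \<in> quotient_module (p_diag N)"
    have "(\<lambda>n. cinner (?F n) h) sums cinner R h" by (rule sums_cinner_left[OF R])
    then have "cinner R h = 0"
      by (simp add: cinner_scaleC_left cinner_diag_ortho_quotient[OF h] sums_0 sums_unique2[OF _ sums_zero])
    then show "cinner (mult_w f - (mult_w f - R)) h = 0" by simp
  qed
  then show ?thesis using R by simp
qed

text \<open>Moving both shifts across gives the inner product of w f with z U_n, and w f does not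
  distinguish z U_n from U_(n+1), their difference being in w [p].\<close>

lemma cinner_back_z_right_vector:
  assumes "f \<in> quotient_module (p_diag N)"
  shows "cinner (back_z f) (right_vector N n) = cinner f (right_vector N (Suc n))"
proof -
  have "cinner (back_z f) (right_vector N n) = cinner (mult_w f) (mult_z (diag_ortho N n))"
    by (simp add: right_vector_def cinner_back_z[symmetric] back_mult cinner_mult_w[symmetric])
  also have "\<dots> = cinner (mult_w f) (diag_ortho N (Suc n))"
    using cinner_diag_ortho_first[OF cinner_mult_w_diag_shift[OF assms]] by metis
  finally show ?thesis by (simp add: right_vector_def cinner_mult_w)
qed

lemma cross_commutator_sums:
  assumes N: "N \<ge> 1" and f: "f \<in> quotient_module (p_diag N)"
  shows "(\<lambda>n. scaleC (cinner f (right_vector N n))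
      (scaleC (of_real (- t_coeff n N)) (left_vector N n))) sums cross_commutator (p_diag N) f"
proof -
  let ?c = "\<lambda>n. cinner f (right_vector N n)"
  let ?U = "diag_ortho N" and ?t = "\<lambda>n. complex_of_real (t_coeff n N)"
  have 1: "(\<lambda>n. back_z (scaleC (?t n * ?c n) (?U n))) sums back_z (mult_w f - S_w (p_diag N) f)"
    by (rule bounded_linear.sums[OF bounded_linear_back_z S_w_sums[OF assms]])
  have "(\<lambda>n. scaleC (?t n * cinner (back_z f) (right_vector N n)) (?U n))
      sums (mult_w (back_z f) - S_w (p_diag N) (back_z f))"
    by (rule S_w_sums[OF N back_z_mem_quotient_module[OF f]])
  then have "(\<lambda>n. scaleC (?t n * ?c (Suc n)) (?U n)) sums (mult_w (back_z f) - S_w (p_diag N) (back_z f))"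
    by (simp only: cinner_back_z_right_vector[OF f])
  \<comment> \<open>Reindexed with a zero term in front, so that both series carry the functional of
    the same \<open>right_vector N n\<close>; this is the origin of the case distinction in
    \<open>left_vector\<close>.\<close>
  then have 2: "(\<lambda>n. if n = 0 then 0 else scaleC (?t (n - 1) * ?c n) (?U (n - 1)))
      sums (mult_w (back_z f) - S_w (p_diag N) (back_z f))"
    by (subst sums_Suc_iff[symmetric, where s = "mult_w (back_z f) - S_w (p_diag N) (back_z f)", of
        "\<lambda>n. if n = 0 then 0 else scaleC (?t (n - 1) * ?c n) (?U (n - 1))", simplified]) simp
  have "cross_commutator (p_diag N) f
      = (mult_w (back_z f) - S_w (p_diag N) (back_z f)) - back_z (mult_w f - S_w (p_diag N) f)"
    by (simp add: cross_commutator_eq[OF f] back_linear back_mult)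
  moreover have "(if n = 0 then 0 else scaleC (?t (n - 1) * ?c n) (?U (n - 1)))
      - back_z (scaleC (?t n * ?c n) (?U n))
      = scaleC (?c n) (scaleC (of_real (- t_coeff n N)) (left_vector N n))" for n
    using t_coeff_pos[of n N]
    by (simp add: left_vector_def back_linear hardy2.scale_right_diff_distrib mult_ac)
  ultimately show ?thesis using sums_diff[OF 2 1] by simp
qed

lemma orthogonal_expansion_cross_commutator:
  assumes N: "N \<ge> 1"
  shows "orthogonal_expansion (quotient_module (p_diag N)) (cross_commutator (p_diag N))
    (right_vector N) (\<lambda>n. scaleC (of_real (- t_coeff n N)) (left_vector N n))"
proof
  fix m n :: nat
  have "norm (right_vector N n) * norm (scaleC (of_real (- t_coeff n N)) (left_vector N n)) > 0"
    using \<beta>_pos[OF N] by (simp only: norm_left_right_vector[OF N])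
  then show "right_vector N n \<noteq> 0" "scaleC (of_real (- t_coeff n N)) (left_vector N n) \<noteq> 0"
    by auto
  show "cinner (right_vector N m) (right_vector N n) = 0" if "m \<noteq> n"
    by (rule left_right_vector_orthogonal[OF N that])
  show "cinner (scaleC (of_real (- t_coeff m N)) (left_vector N m))
      (scaleC (of_real (- t_coeff n N)) (left_vector N n)) = 0" if "m \<noteq> n"
    by (simp add: cinner_simps left_right_vector_orthogonal[OF N that])
  show "(\<lambda>n. norm (right_vector N n) * norm (scaleC (of_real (- t_coeff n N)) (left_vector N n)))
      \<longlonglongrightarrow> 0"
    unfolding norm_left_right_vector[OF N] by (rule \<beta>_tendsto_0[OF N])
qed (use cross_commutator_sums[OF N] right_vector_mem[OF N] subspace_quotient_module
    closed_quotient_module in auto)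

section \<open>Homogeneity of the powers of z - w and the conclusion\<close>

lemma homogeneous_of_degree_mult:
  assumes "homogeneous_of_degree d p" "homogeneous_of_degree e q"
  shows "homogeneous_of_degree (d + e) (p * q)"
  unfolding homogeneous_of_degree_def
proof (intro allI impI)
  fix i j assume "coeff (coeff (p * q) j) i \<noteq> 0"
  then have "(\<Sum>l\<le>j. \<Sum>k\<le>i. coeff (coeff p l) k * coeff (coeff q (j - l)) (i - k)) \<noteq> 0"
    by (simp add: coeff_mult coeff_sum)
  then obtain l k where lk: "l \<le> j" "k \<le> i" "coeff (coeff p l) k * coeff (coeff q (j - l)) (i - k) \<noteq> 0"
    by (metis (no_types, lifting) atMost_iff sum.neutral)
  then have "k + l = d" "i - k + (j - l) = e"
    using assms unfolding homogeneous_of_degree_def by auto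
  then show "i + j = d + e" using lk by simp
qed

lemma nonconstant_homogeneous_p_diag:
  assumes "N \<ge> 1"
  shows "nonconstant_homogeneous (p_diag N)"
proof -
  let ?d = "[:[:0, 1:]:] - [:0, 1:] :: complex poly poly"
  have "homogeneous_of_degree 1 ?d"
    unfolding homogeneous_of_degree_def by (auto simp: coeff_pCons split: nat.splits)
  then have "homogeneous_of_degree N (?d ^ N)"
  proof (induction N)
    case 0
    show ?case by (auto simp: homogeneous_of_degree_def coeff_1 split: if_splits)
  next
    case (Suc N)
    then show ?case using homogeneous_of_degree_mult[of 1 ?d N "?d ^ N"] by simp
  qed
  moreover have "?d \<noteq> 0" by simp
  ultimately show ?thesis
    using assms unfolding nonconstant_homogeneous_def p_diag_def by auto
qed

theorem theorem6p9:
  shows "(\<forall>N \<ge> 1.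
      enumerates_nonzero_singular_values (quotient_module (p_diag N)) (cross_commutator (p_diag N))
        (\<lambda>n. \<beta> n N) \<and>
      hilbert_schmidt_on (quotient_module (p_diag N)) (cross_commutator (p_diag N)) \<and>
      real N / 4 * (1 - (2 / 3) ^ N)\<^sup>2 \<le> (hs_norm_commutator (p_diag N))\<^sup>2 \<and>
      (hs_norm_commutator (p_diag N))\<^sup>2 < real N + 1)
    \<and> (\<lambda>N. (hs_norm_commutator (p_diag N))\<^sup>2 / real N) \<longlonglongrightarrow> 1
    \<and> \<not> (\<exists>C. \<forall>p. nonconstant_homogeneous p \<longrightarrow> hs_norm_commutator p \<le> C)"
proof -
  have main: "enumerates_nonzero_singular_values (quotient_module (p_diag N))
        (cross_commutator (p_diag N)) (\<lambda>n. \<beta> n N)"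
      "hilbert_schmidt_on (quotient_module (p_diag N)) (cross_commutator (p_diag N))"
      "(hs_norm_commutator (p_diag N))\<^sup>2 = (\<Sum>n. (\<beta> n N)\<^sup>2)" if N: "N \<ge> 1" for N
  proof -
    interpret orthogonal_expansion "quotient_module (p_diag N)" "cross_commutator (p_diag N)"
      "right_vector N" "\<lambda>n. scaleC (of_real (- t_coeff n N)) (left_vector N n)"
      by (rule orthogonal_expansion_cross_commutator[OF N])
    note thms = singular_values hilbert_schmidt
    show "enumerates_nonzero_singular_values (quotient_module (p_diag N))
        (cross_commutator (p_diag N)) (\<lambda>n. \<beta> n N)"
      "hilbert_schmidt_on (quotient_module (p_diag N)) (cross_commutator (p_diag N))"
      "(hs_norm_commutator (p_diag N))\<^sup>2 = (\<Sum>n. (\<beta> n N)\<^sup>2)"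
      using thms[unfolded norm_left_right_vector[OF N]] summable_\<beta>_sq[OF N]
      by (simp_all add: hs_norm_commutator_def)
  qed
  have "(\<lambda>N. (hs_norm_commutator (p_diag N))\<^sup>2 / real N) \<longlonglongrightarrow> 1"
  proof (rule Lim_transform_eventually[OF suminf_\<beta>_sq_over_tendsto])
    show "\<forall>\<^sub>F N in sequentially. (\<Sum>n. (\<beta> n N)\<^sup>2) / real N = (hs_norm_commutator (p_diag N))\<^sup>2 / real N"
      using eventually_ge_at_top[of 1] by eventually_elim (simp only: main(3))
  qed
  moreover have unbounded: False if C: "\<forall>p. nonconstant_homogeneous p \<longrightarrow> hs_norm_commutator p \<le> C" for C
  proof -
    \<comment> \<open>For \<open>N >= 1\<close> the factor \<open>1 - (2/3)^N\<close> is at least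
      1/3, so the squared norm is at least N/36.\<close>
    obtain N where N: "real N > 36 * C\<^sup>2" using reals_Archimedean2 by blast
    then have N1: "N \<ge> 1" using zero_le_power2[of C] by (cases N) auto
    have h: "hs_norm_commutator (p_diag N) \<le> C"
      using C nonconstant_homogeneous_p_diag[OF N1] by blast
    have "hs_norm_commutator (p_diag N) \<ge> 0"
      unfolding hs_norm_commutator_def hs_norm_on_def by (simp add: infsum_nonneg)
    then have "(hs_norm_commutator (p_diag N))\<^sup>2 \<le> C\<^sup>2"
      using h by (intro power_mono)
    moreover have "(2 / 3 :: real) ^ N \<le> (2 / 3) ^ 1"
      using N1 by (intro power_decreasing) auto
    then have "(1 / 3)\<^sup>2 \<le> (1 - (2 / 3 :: real) ^ N)\<^sup>2"
      by (intro power_mono) auto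
    then have "real N / 4 * (1 / 3)\<^sup>2 \<le> real N / 4 * (1 - (2 / 3) ^ N)\<^sup>2"
      by (intro mult_left_mono) auto
    ultimately show False
      using suminf_\<beta>_sq_ge_quarter[OF N1] main(3)[OF N1] N by (simp add: power2_eq_square)
  qed
  ultimately show ?thesis
    using main suminf_\<beta>_sq_less suminf_\<beta>_sq_ge_quarter by (intro conjI) (simp_all, blast)
qed

end
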